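(* Let $\mu_1,\dots,\mu_N$ be absolutely continuous measures on $\mathbb{R}^n$, each with finite total mass, and let $0<m\le \min_{1\le j\le N}\mathcal{M}(\mu_j)$. Consider the two problems $$(\mathrm{MM}_m)\quad \min\{\mathcal{C}(\sigma'):\ \sigma'\in\Pi_{\le}(\mu_1,\dots,\mu_N),\ \mathcal{M}(\sigma')=m\},\qquad (\mathrm{BC}_m)\quad \min_{\nu\in\mathcal{P}^m}\ \sum_{j=1}^N \mathcal{MK}^2_{2,m}(\mu_j,\nu).$$ Let $A(x_1,\dots,x_N):=\frac1N\sum_{j=1}^N x_j$. Then: (i) For any optimal measure $\sigma$ in $(\mathrm{MM}_m)$, the push-forward $A_\#\sigma$ is optimal in $(\mathrm{BC}_m)$. (ii) Conversely, for any minimizer $\nu$ in $(\mathrm{BC}_m)$, the measure $(S^\nu_1,\dots,S^\nu_N)_\#\nu$ is optimal in $(\mathrm{MM}_m)$, where for each $1\le j\le N$, $S^\nu_j$ is the optimal mapping such that $(S^\nu_j\times\mathrm{Id})_\#\nu\in\mathrm{Opt}_m(\mu_j,\nu)$. (iii) The minimizer of $(\mathrm{MM}_m)$ is unique if and only if the minimizer of $(\mathrm{BC}_m)$ is unique.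
   Context: "Measure" means positive Borel measure; every measure on $\mathbb{R}^n$ is assumed to have finite second moment. "Absolutely continuous" is with respect to Lebesgue measure. $\mathcal{M}(\mu)$ is the total mass of $\mu$. For measures, $\mu'\le\mu$ means $\mu'(E)\le\mu(E)$ for all measurable $E$. $\pi_j$ is projection onto the $j$th coordinate. $\mathcal{P}^m$ is the set of measures $\nu$ on $\mathbb{R}^n$ with $\mathcal{M}(\nu)=m$ and $\int|x|^2\,\nu(dx)<\infty$. Two-marginal partial transport: $\Pi_{\le}(\mu,\nu)$ is the set of measures $\gamma$ on $\mathbb{R}^n\times\mathbb{R}^n$ with $(\pi_1)_\#\gamma\le\mu$ and $(\pi_2)_\#\gamma\le\nu$. For $0\le m\le\min\{\mathcal{M}(\mu),\mathcal{M}(\nu)\}$, $$\mathcal{MK}^2_{2,m}(\mu,\nu):=\min_{\gamma\in\Pi_{\le}(\mu,\nu),\ \mathcal{M}(\gamma)=m}\int|x-y|^2\,\gamma(dx,dy),$$ and $\mathrm{Opt}_m(\mu,\nu)$ is the set of minimizers. $(S\times\mathrm{Id})$ denotes the map $y\mapsto(S(y),y)$. Multi-marginal: $\Pi_{\le}(\mu_1,\dots,\mu_N)$ is the set of measures on $(\mathbb{R}^n)^N$ whose $j$th marginal is $\le\mu_j$ for each $j$, and $$\mathcal{C}(\sigma):=\int_{(\mathbb{R}^n)^N}\sum_{j\ne k}|x_j-x_k|^2\,\sigma(dx_1,\dots,dx_N).$$ *)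

theory Defs
  imports "HOL-Analysis.Analysis"
begin

definition mass :: "'a measure \<Rightarrow> ennreal" where
  "mass \<mu> = emeasure \<mu> (space \<mu>)"

definition second_moment :: "'a::euclidean_space measure \<Rightarrow> ennreal" where
  "second_moment \<mu> = (\<integral>\<^sup>+x. ennreal ((norm x)\<^sup>2) \<partial>\<mu>)"

text \<open>Finiteness of the second moment does not imply finiteness of the total mass, so
  that is not part of this predicate.\<close>

definition borel_measure2 :: "'a::euclidean_space measure \<Rightarrow> bool" where
  "borel_measure2 \<mu> \<longleftrightarrow> sets \<mu> = sets borel \<and> second_moment \<mu> < \<infinity>"

definition measures_of_mass :: "real \<Rightarrow> 'a::euclidean_space measure set" where
  "measures_of_mass m = {\<nu>. borel_measure2 \<nu> \<and> mass \<nu> = ennreal m}"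

text \<open>The order on the type of measures compares spaces and \<open>\<sigma>\<close>-algebras first. Below it
  is only used between Borel measures, where it is the setwise order (\<open>le_measure\<close>).\<close>

definition partial_couplings ::
  "(real^'n) measure \<Rightarrow> (real^'n) measure \<Rightarrow> ((real^'n) \<times> (real^'n)) measure set" where
  "partial_couplings \<mu> \<nu> =
     {\<gamma>. sets \<gamma> = sets borel \<and> distr \<gamma> borel fst \<le> \<mu> \<and> distr \<gamma> borel snd \<le> \<nu>}"

definition transport_cost :: "((real^'n) \<times> (real^'n)) measure \<Rightarrow> ennreal" where
  "transport_cost \<gamma> = (\<integral>\<^sup>+(x, y). ennreal ((norm (x - y))\<^sup>2) \<partial>\<gamma>)"

definition MK2 :: "real \<Rightarrow> (real^'n) measure \<Rightarrow> (real^'n) measure \<Rightarrow> ennreal" where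
  "MK2 m \<mu> \<nu> = (INF \<gamma>\<in>{\<gamma> \<in> partial_couplings \<mu> \<nu>. mass \<gamma> = ennreal m}. transport_cost \<gamma>)"

definition Opt ::
  "real \<Rightarrow> (real^'n) measure \<Rightarrow> (real^'n) measure \<Rightarrow> ((real^'n) \<times> (real^'n)) measure set" where
  "Opt m \<mu> \<nu> =
     {\<gamma>. is_arg_min transport_cost (\<lambda>\<gamma>. \<gamma> \<in> partial_couplings \<mu> \<nu> \<and> mass \<gamma> = ennreal m) \<gamma>}"

text \<open>A point of \<open>(\<real>\<^sup>n)\<^sup>N\<close> is a vector \<open>x :: real^'n^'N\<close>, so that \<open>x $ j\<close> is its \<open>j\<close>-th
  component in \<open>\<real>\<^sup>n\<close>, and \<open>N = CARD('N)\<close>.\<close>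

definition multi_partial_couplings ::
  "('N::finite \<Rightarrow> (real^'n) measure) \<Rightarrow> (real^'n^'N) measure set" where
  "multi_partial_couplings \<mu> =
     {\<sigma>. sets \<sigma> = sets borel \<and> (\<forall>j. distr \<sigma> borel (\<lambda>x. x $ j) \<le> \<mu> j)}"

text \<open>The sum runs over ordered pairs \<open>(j, k)\<close>.\<close>

definition multi_cost :: "(real^'n^'N) measure \<Rightarrow> ennreal" where
  "multi_cost \<sigma> =
     (\<integral>\<^sup>+x. ennreal (\<Sum>(j, k)\<in>{(j, k). j \<noteq> k}. (norm (x $ j - x $ k))\<^sup>2) \<partial>\<sigma>)"

definition MM_optimal ::
  "real \<Rightarrow> ('N::finite \<Rightarrow> (real^'n) measure) \<Rightarrow> (real^'n^'N) measure \<Rightarrow> bool" where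
  "MM_optimal m \<mu> =
     is_arg_min multi_cost (\<lambda>\<sigma>. \<sigma> \<in> multi_partial_couplings \<mu> \<and> mass \<sigma> = ennreal m)"

definition BC_optimal ::
  "real \<Rightarrow> ('N::finite \<Rightarrow> (real^'n) measure) \<Rightarrow> (real^'n) measure \<Rightarrow> bool" where
  "BC_optimal m \<mu> =
     is_arg_min (\<lambda>\<nu>. \<Sum>j\<in>UNIV. MK2 m (\<mu> j) \<nu>) (\<lambda>\<nu>. \<nu> \<in> measures_of_mass m)"

definition average :: "real^'n^'N \<Rightarrow> real^'n" where
  "average x = (1 / real CARD('N)) *\<^sub>R (\<Sum>j\<in>UNIV. x $ j)"

definition optimal_map ::
  "real \<Rightarrow> (real^'n) measure \<Rightarrow> (real^'n) measure \<Rightarrow> (real^'n \<Rightarrow> real^'n) \<Rightarrow> bool" where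
  "optimal_map m \<mu> \<nu> S \<longleftrightarrow>
     S \<in> borel_measurable borel \<and> distr \<nu> borel (\<lambda>y. (S y, y)) \<in> Opt m \<mu> \<nu>"

end

theory Submission imports Defs "HOL-Probability.Giry_Monad" "HOL-Probability.Infinite_Product_Measure"
begin

text \<open>
  Since \<open>\<Sum>j. |x\<^sub>j - y|\<^sup>2 = \<Sum>j. |x\<^sub>j - A x|\<^sup>2 + N |A x - y|\<^sup>2\<close>, gluing couplings of the
  \<open>\<mu>\<^sub>j\<close> with \<open>\<nu>\<close> along \<open>\<nu>\<close> yields a multi-marginal coupling whose cost is at most \<open>2 N\<close> times
  their total cost, and strictly less unless \<open>y = A x\<close> almost everywhere. Instead of
  disintegrating, the couplings are glued conditionally independently over a countable partition of
  the space of \<open>y\<close> into cells of small diameter. If \<open>\<nu>\<close> is optimal and the couplings are nearly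
  so, then \<open>A x\<close> is close to \<open>y\<close>; since the \<open>x\<^sub>j\<close> are independent within a cell, freezing all but
  one of them (Fubini) shows that each coupling is nearly concentrated on the graph of a map of \<open>y\<close>.
  Applied to midpoints of near-optimal couplings this makes the maps a Cauchy sequence in
  \<open>L\<^sup>2(\<nu>)\<close>, which gives the existence of the optimal maps, and likewise their uniqueness.
  Consequently \<open>\<sigma> \<mapsto> A\<^sub>#\<sigma>\<close> and \<open>\<nu> \<mapsto> (S\<^sub>1, \<dots>, S\<^sub>N)\<^sub>#\<nu>\<close> are mutually inverse bijections
  between the two sets of minimizers.
\<close>

section \<open>Gluing measures conditionally independently\<close>

lemma nn_integral_nat_measure:
  fixes p :: "nat measure" and g :: "nat \<Rightarrow> ennreal"
  assumes "sets p = UNIV"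
  shows "(\<integral>\<^sup>+i. g i \<partial>p) = (\<Sum>i. g i * emeasure p {i})"
proof -
  have sp: "space p = UNIV" using assms sets_eq_imp_space_eq[of p "count_space UNIV"] by simp
  have m: "h \<in> borel_measurable p" for h :: "nat \<Rightarrow> ennreal"
    using assms sp by (simp add: measurable_def)
  have "(\<integral>\<^sup>+i. g i \<partial>p) = (\<integral>\<^sup>+k. (\<Sum>i. g i * indicator {i} k) \<partial>p)"
  proof (rule nn_integral_cong)
    fix k
    have "(\<Sum>i. g i * indicator {i} k) = (\<Sum>i\<in>{k}. g i * indicator {i} k)"
      by (rule suminf_finite) auto
    then show "g k = (\<Sum>i. g i * indicator {i} k)" by simp
  qed
  also have "\<dots> = (\<Sum>i. \<integral>\<^sup>+k. g i * indicator {i} k \<partial>p)"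
    by (rule nn_integral_suminf) (rule m)
  also have "\<dots> = (\<Sum>i. g i * emeasure p {i})"
    by (subst nn_integral_cmult_indicator) (auto simp: assms)
  finally show ?thesis .
qed

lemma prob_space_exists_le_nn_integral:
  assumes "prob_space M" "h \<in> borel_measurable M"
  shows "\<exists>x\<in>space M. h x \<le> (\<integral>\<^sup>+x. h x \<partial>M)"
proof (rule ccontr)
  interpret prob_space M by fact
  let ?I = "\<integral>\<^sup>+x. h x \<partial>M"
  assume "\<not> ?thesis"
  then have less: "?I < h x" if "x \<in> space M" for x using that by (auto simp: not_le)
  obtain x0 where "x0 \<in> space M" using not_empty by auto
  then have "?I \<noteq> \<infinity>" using less by fastforce
  have "(\<integral>\<^sup>+x. ?I \<partial>M) < ?I"
  proof (rule nn_integral_less)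
    show "\<not> (AE x in M. h x \<le> ?I)"
    proof
      assume "AE x in M. h x \<le> ?I"
      then have "AE x in M. False" by (rule AE_mp) (use less in \<open>auto simp: not_le intro!: AE_I2\<close>)
      then show False by simp
    qed
    show "AE x in M. ?I \<le> h x" using less by (auto intro!: AE_I2 less_imp_le)
  qed (use assms \<open>?I \<noteq> \<infinity>\<close> in \<open>auto simp: emeasure_space_1\<close>)
  then show False by (simp add: emeasure_space_1)
qed

text \<open>By Fubini the integral over the product is the mean, over the coordinates other than
  \<open>j\<close>, of the integral in the \<open>j\<close>-th coordinate, and some section does not
  exceed the mean.\<close>

lemma PiM_exists_section_le:
  fixes P :: "'i::finite \<Rightarrow> 'z measure"
  assumes "\<And>j. prob_space (P j)" "F \<in> borel_measurable (Pi\<^sub>M UNIV P)"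
  shows "\<exists>w. (\<integral>\<^sup>+z. F (w(j := z)) \<partial>P j) \<le> (\<integral>\<^sup>+\<omega>. F \<omega> \<partial>Pi\<^sub>M UNIV P)"
proof -
  interpret product_prob_space P UNIV using assms(1)
    by (simp add: product_prob_space_def product_prob_space_axioms_def product_sigma_finite_def prob_space_imp_sigma_finite)
  have U: "UNIV = insert j (UNIV - {j})" by auto
  have F: "F \<in> borel_measurable (Pi\<^sub>M (insert j (UNIV - {j})) P)" using assms(2) U by simp
  have [measurable]: "(\<lambda>x. \<integral>\<^sup>+z. F (x(j := z)) \<partial>P j) \<in> borel_measurable (Pi\<^sub>M (UNIV - {j}) P)"
  proof (rule sigma_finite_measure.borel_measurable_nn_integral)
    show "sigma_finite_measure (P j)" by (simp add: assms(1) prob_space_imp_sigma_finite)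
    show "(\<lambda>(x, z). F (x(j := z))) \<in> borel_measurable (Pi\<^sub>M (UNIV - {j}) P \<Otimes>\<^sub>M P j)"
      using measurable_compose[OF measurable_add_dim F] by (simp add: split_beta')
  qed
  have "\<exists>w\<in>space (Pi\<^sub>M (UNIV - {j}) P). (\<integral>\<^sup>+z. F (w(j := z)) \<partial>P j)
      \<le> (\<integral>\<^sup>+w. \<integral>\<^sup>+z. F (w(j := z)) \<partial>P j \<partial>Pi\<^sub>M (UNIV - {j}) P)"
    by (rule prob_space_exists_le_nn_integral) (auto intro: prob_space_PiM assms)
  moreover have "(\<integral>\<^sup>+w. \<integral>\<^sup>+z. F (w(j := z)) \<partial>P j \<partial>Pi\<^sub>M (UNIV - {j}) P) = (\<integral>\<^sup>+\<omega>. F \<omega> \<partial>Pi\<^sub>M UNIV P)"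
    using product_nn_integral_insert[OF _ _ F] U by simp
  ultimately show ?thesis by metis
qed

lemma glue_conditionally_independent:
  fixes \<gamma> :: "'i::finite \<Rightarrow> 'z::topological_space measure" and idx :: "'z \<Rightarrow> nat"
  assumes sets: "\<And>j. sets (\<gamma> j) = sets borel"
    and idx: "idx \<in> borel \<rightarrow>\<^sub>M count_space UNIV"
    and law: "\<And>j. distr (\<gamma> j) (count_space UNIV) idx = p"
    and fin: "finite_measure p"
  obtains \<tau> :: "('i \<Rightarrow> 'z) measure" where
    "sets \<tau> = sets (Pi\<^sub>M UNIV (\<lambda>_. borel))"
    "\<And>j. distr \<tau> borel (\<lambda>\<omega>. \<omega> j) = \<gamma> j"
    "AE \<omega> in \<tau>. \<forall>j k. idx (\<omega> j) = idx (\<omega> k)"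
    "\<And>F j. F \<in> borel_measurable (Pi\<^sub>M UNIV (\<lambda>_. borel)) \<Longrightarrow>
       \<exists>w :: nat \<Rightarrow> 'i \<Rightarrow> 'z. (\<integral>\<^sup>+z. F ((w (idx z))(j := z)) \<partial>\<gamma> j) \<le> (\<integral>\<^sup>+\<omega>. F \<omega> \<partial>\<tau>)"
proof -
  define Z where "Z = Pi\<^sub>M (UNIV :: 'i set) (\<lambda>_. borel :: 'z measure)"
  define q where "q i = emeasure p {i}" for i
  define P where "P i j = uniform_measure (\<gamma> j) {z. idx z = i}" for i j
  \<comment> \<open>On a cell of mass zero the conditional measures are not probability measures.
    The null measure is a harmless default there, since such a cell has weight
    \<open>q i = 0\<close> in every sum below.\<close>
  define K where "K i = (if q i = 0 then null_measure Z else Pi\<^sub>M UNIV (P i))" for i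
  define \<tau> where "\<tau> = p \<bind> K"
  have spaceG: "space (\<gamma> j) = UNIV" for j using sets_eq_imp_space_eq[OF sets, of j] by simp
  have setsp: "sets p = UNIV" using law[of undefined] by (metis Pow_UNIV sets_count_space sets_distr)
  then have spacep: "space p = UNIV" using sets_eq_imp_space_eq[of p "count_space UNIV"] by simp
  note sets[measurable_cong] note idx[measurable]
  have Em: "{z. idx z = i} \<in> sets borel" for i by measurable
  have q: "emeasure (\<gamma> j) {z. idx z = i} = q i" for i j
    unfolding q_def law[of j, symmetric]
    by (subst emeasure_distr) (auto simp: spaceG vimage_def sets cong: measurable_cong_sets)
  have qfin: "q i \<noteq> \<infinity>" for i unfolding q_def using fin by (simp add: finite_measure.emeasure_finite)
  have P: "prob_space (P i j)" if "q i \<noteq> 0" for i j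
    unfolding P_def using that qfin q by (intro prob_space_uniform_measure) auto
  have setsP: "sets (P i j) = sets borel" for i j by (simp add: P_def sets)
  have setsPi: "sets (Pi\<^sub>M UNIV (P i)) = sets Z" for i
    unfolding Z_def by (rule sets_PiM_cong) (auto simp: setsP)
  have setsK: "sets (K i) = sets Z" for i by (simp add: K_def setsPi)
  have neZ: "space Z \<noteq> {}" by (simp add: Z_def space_PiM PiE_eq_empty_iff)
  have subK: "K i \<in> space (subprob_algebra Z)" for i
  proof -
    have "subprob_space (K i)"
    proof (cases "q i = 0")
      case True
      then show ?thesis using neZ by (auto simp: K_def intro!: subprob_spaceI)
    next
      case False
      then show ?thesis using prob_space_PiM[of UNIV "P i"] P
        by (auto simp: K_def intro: prob_space_imp_subprob_space)
    qed
    then show ?thesis by (simp add: space_subprob_algebra setsK)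
  qed
  have K[measurable]: "K \<in> p \<rightarrow>\<^sub>M subprob_algebra Z"
    using setsp spacep subK by (auto simp: measurable_def)
  have sets\<tau>: "sets \<tau> = sets Z" unfolding \<tau>_def by (rule sets_bind) (auto simp: setsK spacep)
  have int\<tau>: "(\<integral>\<^sup>+\<omega>. F \<omega> \<partial>\<tau>) = (\<Sum>i. (\<integral>\<^sup>+\<omega>. F \<omega> \<partial>K i) * q i)" if "F \<in> borel_measurable Z" for F
    unfolding \<tau>_def q_def by (subst nn_integral_bind[OF that K]) (rule nn_integral_nat_measure[OF setsp])
  \<comment> \<open>Total expectation over the cells.\<close>
  have int\<gamma>: "(\<integral>\<^sup>+z. f z \<partial>\<gamma> j) = (\<Sum>i. (\<integral>\<^sup>+z. f z \<partial>P i j) * q i)"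
    if f[measurable]: "f \<in> borel_measurable borel" for f j
  proof -
    have "(\<integral>\<^sup>+z. f z \<partial>\<gamma> j) = (\<integral>\<^sup>+z. (\<Sum>i. f z * indicator {z. idx z = i} z) \<partial>\<gamma> j)"
    proof (rule nn_integral_cong)
      fix z
      have "(\<Sum>i. f z * indicator {z. idx z = i} z) = (\<Sum>i\<in>{idx z}. f z * indicator {z. idx z = i} z)"
        by (rule suminf_finite) auto
      then show "f z = (\<Sum>i. f z * indicator {z. idx z = i} z)" by simp
    qed
    also have "\<dots> = (\<Sum>i. \<integral>\<^sup>+z. f z * indicator {z. idx z = i} z \<partial>\<gamma> j)"
      by (rule nn_integral_suminf) measurable
    also have "\<dots> = (\<Sum>i. (\<integral>\<^sup>+z. f z \<partial>P i j) * q i)"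
    proof (rule suminf_cong)
      fix i
      show "(\<integral>\<^sup>+z. f z * indicator {z. idx z = i} z \<partial>\<gamma> j) = (\<integral>\<^sup>+z. f z \<partial>P i j) * q i"
      proof (cases "q i = 0")
        case True
        have "AE z in \<gamma> j. f z * indicator {z. idx z = i} z = 0"
          using True q[of j i] Em[of i] sets
          by (intro AE_I[where N = "{z. idx z = i}"]) (auto simp: indicator_def)
        then have "(\<integral>\<^sup>+z. f z * indicator {z. idx z = i} z \<partial>\<gamma> j) = (\<integral>\<^sup>+z. 0 \<partial>\<gamma> j)"
          by (rule nn_integral_cong_AE)
        then show ?thesis using True by simp
      next
        case False
        have "q i / q i = 1" using False qfin[of i] by (simp add: ennreal_divide_self less_top)
        moreover have "(\<integral>\<^sup>+z. f z \<partial>P i j) = (\<integral>\<^sup>+z. f z * indicator {z. idx z = i} z \<partial>\<gamma> j) / q i"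
          unfolding P_def q[of j i, symmetric] by (rule nn_integral_uniform_measure) (auto simp: Em sets)
        ultimately show ?thesis by (simp add: ennreal_divide_times)
      qed
    qed
    finally show ?thesis .
  qed
  have distr\<tau>: "distr \<tau> borel (\<lambda>\<omega>. \<omega> j) = \<gamma> j" for j
  proof (rule measure_eqI)
    fix A assume "A \<in> sets (distr \<tau> borel (\<lambda>\<omega>. \<omega> j))"
    then have A[measurable]: "A \<in> sets borel" by simp
    have m: "(\<lambda>\<omega>. \<omega> j) \<in> Z \<rightarrow>\<^sub>M borel" unfolding Z_def by measurable
    have m': "(\<lambda>\<omega>. \<omega> j) \<in> \<tau> \<rightarrow>\<^sub>M borel" using m sets\<tau> by (simp cong: measurable_cong_sets)
    have "emeasure (distr \<tau> borel (\<lambda>\<omega>. \<omega> j)) A = (\<integral>\<^sup>+\<omega>. indicator A (\<omega> j) \<partial>\<tau>)"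
      by (subst nn_integral_indicator[symmetric], simp, subst nn_integral_distr[OF m']) auto
    also have "\<dots> = (\<Sum>i. (\<integral>\<^sup>+\<omega>. indicator A (\<omega> j) \<partial>K i) * q i)"
      by (rule int\<tau>) (use m in measurable)
    also have "\<dots> = (\<Sum>i. (\<integral>\<^sup>+z. indicator A z \<partial>P i j) * q i)"
    proof (rule suminf_cong)
      fix i
      show "(\<integral>\<^sup>+\<omega>. indicator A (\<omega> j) \<partial>K i) * q i = (\<integral>\<^sup>+z. indicator A z \<partial>P i j) * q i"
      proof (cases "q i = 0")
        case False
        then have "(\<integral>\<^sup>+z. indicator A z \<partial>P i j) = (\<integral>\<^sup>+z. indicator A z \<partial>distr (Pi\<^sub>M UNIV (P i)) (P i j) (\<lambda>\<omega>. \<omega> j))"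
          using distr_PiM_component[of UNIV "P i" j] P by simp
        also have "\<dots> = (\<integral>\<^sup>+\<omega>. indicator A (\<omega> j) \<partial>K i)"
          by (subst nn_integral_distr) (auto simp: K_def False measurable_cong_sets[OF setsP refl])
        finally show ?thesis by simp
      qed simp
    qed
    also have "\<dots> = emeasure (\<gamma> j) A" by (subst int\<gamma>[symmetric]) (auto simp: sets)
    finally show "emeasure (distr \<tau> borel (\<lambda>\<omega>. \<omega> j)) A = emeasure (\<gamma> j) A" .
  qed (simp add: sets)
  have AEP: "AE z in P i j. idx z = i" for i j
    unfolding P_def by (rule AE_uniform_measureI) (auto simp: Em sets)
  have AE: "AE \<omega> in \<tau>. \<forall>j k. idx (\<omega> j) = idx (\<omega> k)"
  proof -
    have "AE \<omega> in K i. \<forall>j. idx (\<omega> j) = i" for i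
    proof (cases "q i = 0")
      case True then show ?thesis by (auto simp: K_def intro!: AE_I[where N = "space Z"])
    next
      case False
      have "AE \<omega> in Pi\<^sub>M UNIV (P i). idx (\<omega> j) = i" for j
        using AE_PiM_component[of UNIV "P i" j "\<lambda>z. idx z = i"] AEP P[OF False] by simp
      moreover have "K i = Pi\<^sub>M UNIV (P i)" using False by (simp add: K_def)
      ultimately show ?thesis unfolding AE_all_countable by metis
    qed
    then have "AE \<omega> in K i. \<forall>j k. idx (\<omega> j) = idx (\<omega> k)" for i by (rule AE_mp) auto
    then show ?thesis unfolding \<tau>_def
      by (subst AE_bind[OF K]) (auto simp: Z_def)
  qed
  have sec: "\<exists>w :: nat \<Rightarrow> 'i \<Rightarrow> 'z. (\<integral>\<^sup>+z. F ((w (idx z))(j := z)) \<partial>\<gamma> j) \<le> (\<integral>\<^sup>+\<omega>. F \<omega> \<partial>\<tau>)"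
    if F: "F \<in> borel_measurable Z" for F j
  proof -
    have "\<exists>w. (\<integral>\<^sup>+z. F (w(j := z)) \<partial>P i j) * q i \<le> (\<integral>\<^sup>+\<omega>. F \<omega> \<partial>K i) * q i" for i
    proof (cases "q i = 0")
      case False
      then obtain w where "(\<integral>\<^sup>+z. F (w(j := z)) \<partial>P i j) \<le> (\<integral>\<^sup>+\<omega>. F \<omega> \<partial>Pi\<^sub>M UNIV (P i))"
        using PiM_exists_section_le[of "P i" F j] P F setsPi[of i] by (auto cong: measurable_cong_sets)
      then show ?thesis using False by (auto simp: K_def intro!: mult_right_mono)
    qed auto
    then obtain w where w: "(\<integral>\<^sup>+z. F ((w i)(j := z)) \<partial>P i j) * q i \<le> (\<integral>\<^sup>+\<omega>. F \<omega> \<partial>K i) * q i" for i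
      by metis
    have m: "(\<lambda>z. F (v(j := z))) \<in> borel_measurable borel" for v
      by (rule measurable_compose[OF _ F]) (auto simp: Z_def intro!: measurable_PiM_single')
    \<comment> \<open>Measurable however the \<open>w i\<close> were chosen, because
      \<open>w (idx z)\<close> is constant on each of countably many cells.\<close>
    have m2: "(\<lambda>z. F ((w (idx z))(j := z))) \<in> borel_measurable borel"
      by (rule measurable_compose_countable'[where g = idx and I = UNIV, OF m]) auto
    have "(\<integral>\<^sup>+z. F ((w (idx z))(j := z)) \<partial>\<gamma> j) = (\<Sum>i. (\<integral>\<^sup>+z. F ((w (idx z))(j := z)) \<partial>P i j) * q i)"
      by (rule int\<gamma>[OF m2])
    also have "\<dots> = (\<Sum>i. (\<integral>\<^sup>+z. F ((w i)(j := z)) \<partial>P i j) * q i)"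
    proof (rule suminf_cong, goal_cases)
      case (1 i)
      have "AE z in P i j. idx z = i" by (rule AEP)
      then have "(\<integral>\<^sup>+z. F ((w (idx z))(j := z)) \<partial>P i j) = (\<integral>\<^sup>+z. F ((w i)(j := z)) \<partial>P i j)"
        by (intro nn_integral_cong_AE) (auto elim!: AE_mp)
      then show ?case by simp
    qed
    also have "\<dots> \<le> (\<Sum>i. (\<integral>\<^sup>+\<omega>. F \<omega> \<partial>K i) * q i)" by (intro suminf_le w) auto
    also have "\<dots> = (\<integral>\<^sup>+\<omega>. F \<omega> \<partial>\<tau>)" by (rule int\<tau>[OF F, symmetric])
    finally show ?thesis by blast
  qed
  show thesis using that[of \<tau>] sets\<tau> distr\<tau> AE sec unfolding Z_def by blast
qed

section \<open>Gluing partial couplings\<close>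

lemma borel_measurable_vec_nth [measurable]:
  "(\<lambda>x::'a::{second_countable_topology,real_normed_vector}^'k. x $ j) \<in> borel_measurable borel"
  by (intro borel_measurable_continuous_onI continuous_intros)

lemma borel_measurable_vec_lambda [measurable (raw)]:
  fixes f :: "'k::finite \<Rightarrow> 'b \<Rightarrow> 'a::euclidean_space"
  assumes "\<And>j. f j \<in> borel_measurable M"
  shows "(\<lambda>x. \<chi> j. f j x) \<in> borel_measurable M"
proof (subst borel_measurable_euclidean_space, safe)
  fix i :: "'a^'k" assume "i \<in> Basis"
  then obtain j u where "i = axis j u" by (auto simp: Basis_vec_def)
  then show "(\<lambda>x. (\<chi> j. f j x) \<bullet> i) \<in> borel_measurable M"
    using assms[of j] by (simp add: inner_axis)
qed

lemma borel_measurable_fst_snd [measurable]: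
  "(fst :: 'a::second_countable_topology \<times> 'b::second_countable_topology \<Rightarrow> 'a) \<in> borel_measurable borel"
  "(snd :: 'a::second_countable_topology \<times> 'b::second_countable_topology \<Rightarrow> 'b) \<in> borel_measurable borel"
  by (simp_all add: borel_prod[symmetric])

lemma borel_measurable_average [measurable]:
  "(average :: real^'n^'N \<Rightarrow> real^'n) \<in> borel_measurable borel"
  unfolding average_def by measurable

text \<open>\<open>N\<close> times the variance of the points \<open>x $ j\<close>, which is the
  minimum over \<open>y\<close> of the sum of their squared distances to \<open>y\<close>.\<close>

definition spread :: "real^'n^'N \<Rightarrow> real" where
  "spread x = (\<Sum>j\<in>UNIV. (norm (x $ j - average x))\<^sup>2)"

lemma borel_measurable_spread [measurable]: "spread \<in> borel_measurable borel"
  unfolding spread_def by measurable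

lemma spread_nonneg: "0 \<le> spread x"
  by (simp add: spread_def sum_nonneg)

text \<open>The parallel axis identity: the deviations from the mean sum to zero, so the cross terms
  vanish.\<close>

lemma sum_dist_sq_eq_spread:
  fixes x :: "real^'n^'N"
  shows "(\<Sum>j\<in>UNIV. (norm (x $ j - y))\<^sup>2) = spread x + real CARD('N) * (norm (average x - y))\<^sup>2"
proof -
  let ?a = "average x"
  have "(\<Sum>j\<in>UNIV. x $ j - ?a) = 0"
    by (simp add: sum_subtractf average_def sum_constant_scaleR del: sum_constant)
  then have "(\<Sum>j\<in>UNIV. 2 * ((x $ j - ?a) \<bullet> (?a - y))) = 0"
    by (simp flip: sum_distrib_left inner_sum_left)
  moreover have "(norm (x $ j - y))\<^sup>2 = (norm (x $ j - ?a))\<^sup>2 + 2 * ((x $ j - ?a) \<bullet> (?a - y)) + (norm (?a - y))\<^sup>2" for j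
    by (simp add: power2_norm_eq_inner inner_diff_left inner_diff_right inner_commute)
  ultimately show ?thesis by (simp add: sum.distrib spread_def)
qed

text \<open>The variance identity at \<open>y = x $ j\<close>, summed over \<open>j\<close>, yields
  the spread \<open>N\<close> times from its first term and \<open>N\<close> times again from its
  second, hence the factor \<open>2 * N\<close>. The diagonal pairs contribute nothing.\<close>

lemma multi_cost_eq_spread:
  fixes \<sigma> :: "(real^'n^'N) measure"
  assumes "sets \<sigma> = sets borel"
  shows "multi_cost \<sigma> = ennreal (2 * real CARD('N)) * (\<integral>\<^sup>+x. ennreal (spread x) \<partial>\<sigma>)"
proof -
  have "(\<Sum>(j, k)\<in>{(j, k). j \<noteq> k}. (norm (x $ j - x $ k))\<^sup>2) = 2 * real CARD('N) * spread x" for x :: "real^'n^'N"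
  proof -
    have "(\<Sum>(j, k)\<in>{(j, k). j \<noteq> k}. (norm (x $ j - x $ k))\<^sup>2) = (\<Sum>(j, k)\<in>UNIV. (norm (x $ j - x $ k))\<^sup>2)"
      by (rule sum.mono_neutral_left) auto
    also have "\<dots> = (\<Sum>j\<in>UNIV. \<Sum>k\<in>UNIV. (norm (x $ k - x $ j))\<^sup>2)"
      by (simp add: sum.cartesian_product norm_minus_commute)
    also have "\<dots> = (\<Sum>j\<in>UNIV. spread x + real CARD('N) * (norm (x $ j - average x))\<^sup>2)"
      by (intro sum.cong refl) (simp only: sum_dist_sq_eq_spread norm_minus_commute[of "average x"])
    also have "\<dots> = 2 * real CARD('N) * spread x"
      by (simp add: sum.distrib spread_def sum_distrib_left[symmetric])
    finally show ?thesis .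
  qed
  moreover have "(\<integral>\<^sup>+x. ennreal (2 * real CARD('N)) * ennreal (spread x) \<partial>\<sigma>) = ennreal (2 * real CARD('N)) * (\<integral>\<^sup>+x. ennreal (spread x) \<partial>\<sigma>)"
    by (rule nn_integral_cmult) (simp add: assms cong: measurable_cong_sets)
  ultimately show ?thesis
    by (simp add: multi_cost_def ennreal_mult spread_nonneg)
qed

text \<open>The cell of \<open>x\<close> is numbered by the first point of a dense sequence at
  distance less than \<open>\<delta> / 2\<close> from \<open>x\<close>.\<close>

lemma exists_small_diameter_index:
  assumes "0 < \<delta>"
  obtains idx :: "'a::{metric_space, second_countable_topology} \<Rightarrow> nat"
  where "idx \<in> borel \<rightarrow>\<^sub>M count_space UNIV" "\<And>x y. idx x = idx y \<Longrightarrow> dist x y < \<delta>"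
proof -
  obtain D :: "'a set" where D: "countable D" "\<And>X. open X \<Longrightarrow> X \<noteq> {} \<Longrightarrow> \<exists>d\<in>D. d \<in> X"
    using countable_dense_setE by blast
  define d where "d = from_nat_into D"
  define idx where "idx x = (LEAST i. dist x (d i) < \<delta> / 2)" for x
  have D0: "D \<noteq> {}" using D(2)[of UNIV] by auto
  have near: "dist x (d (idx x)) < \<delta> / 2" for x
  proof -
    obtain c where "c \<in> D" "c \<in> ball x (\<delta> / 2)" using D(2)[of "ball x (\<delta> / 2)"] assms by auto
    then obtain i where "dist x (d i) < \<delta> / 2"
      unfolding d_def using from_nat_into_surj[OF D(1)] by (metis mem_ball)
    then show ?thesis unfolding idx_def by (rule LeastI)
  qed
  have "dist x y < \<delta>" if "idx x = idx y" for x y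
    using near[of x] near[of y] that dist_triangle_half_r by (metis dist_commute)
  moreover have "idx \<in> borel \<rightarrow>\<^sub>M count_space UNIV" unfolding idx_def by measurable
  ultimately show thesis by (rule that[rotated])
qed

text \<open>Young's inequality with weight \<delta>. The coefficient of the main term stays close to
  1, which is needed wherever a cost is compared with an optimal one; \<delta> = 1 suffices for
  crude bounds.\<close>

lemma norm_add_sq_le:
  fixes a b :: "'a::real_inner"
  assumes "0 < \<delta>"
  shows "(norm (a + b))\<^sup>2 \<le> (1 + \<delta>) * (norm a)\<^sup>2 + (1 + 1 / \<delta>) * (norm b)\<^sup>2"
proof -
  have "2 * (norm a * norm b) \<le> \<delta> * (norm a)\<^sup>2 + 1 / \<delta> * (norm b)\<^sup>2"
  proof -
    have "0 \<le> (\<delta> * norm a - norm b)\<^sup>2 / \<delta>" using assms by simp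
    also have "\<dots> = \<delta> * (norm a)\<^sup>2 + 1 / \<delta> * (norm b)\<^sup>2 - 2 * (norm a * norm b)"
      using assms by (simp add: power2_eq_square field_simps)
    finally show ?thesis by simp
  qed
  moreover have "(norm (a + b))\<^sup>2 \<le> (norm a + norm b)\<^sup>2"
    by (intro power_mono norm_triangle_ineq) auto
  ultimately show ?thesis by (simp add: power2_sum algebra_simps)
qed

lemma ennreal_norm_diff_sq_le:
  fixes a b c :: "'a::real_inner"
  shows "ennreal ((norm (a - c))\<^sup>2) \<le> 2 * ennreal ((norm (a - b))\<^sup>2) + 2 * ennreal ((norm (c - b))\<^sup>2)"
proof -
  have "(norm (a - c))\<^sup>2 \<le> 2 * (norm (a - b))\<^sup>2 + 2 * (norm (c - b))\<^sup>2"
    using norm_add_sq_le[of 1 "a - b" "b - c"] by (simp add: norm_minus_commute)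
  then have "ennreal ((norm (a - c))\<^sup>2) \<le> ennreal (2 * (norm (a - b))\<^sup>2 + 2 * (norm (c - b))\<^sup>2)" by (rule ennreal_leI)
  then show ?thesis by (simp add: ennreal_mult)
qed

text \<open>A deficit of the marginal on \<open>A\<close> would need a surplus on the complement to
  reach the full mass, which the constraint excludes. Finite mass permits the cancellation.\<close>

lemma partial_coupling_snd_eq:
  assumes "\<gamma> \<in> partial_couplings \<mu> \<nu>" "mass \<gamma> = mass \<nu>" "mass \<nu> < \<infinity>" "sets \<nu> = sets borel"
  shows "distr \<gamma> borel snd = \<nu>"
proof (rule measure_eqI)
  have s: "sets \<gamma> = sets borel" and le: "distr \<gamma> borel snd \<le> \<nu>"
    using assms(1) by (auto simp: partial_couplings_def)
  show "sets (distr \<gamma> borel snd) = sets \<nu>" using assms(4) by simp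
  have sp: "space \<gamma> = UNIV" "space \<nu> = UNIV"
    using sets_eq_imp_space_eq[OF s] sets_eq_imp_space_eq[OF assms(4)] by auto
  have snd: "snd \<in> \<gamma> \<rightarrow>\<^sub>M borel" using s by (simp cong: measurable_cong_sets)
  have le': "emeasure (distr \<gamma> borel snd) A \<le> emeasure \<nu> A" for A
    using le assms(4) by (intro le_measureD3) auto
  fix A assume "A \<in> sets (distr \<gamma> borel snd)"
  then have A: "A \<in> sets borel" by simp
  have "emeasure \<nu> A + emeasure \<nu> (- A) = mass \<nu>"
    using A assms(4) sp by (simp add: mass_def plus_emeasure Un_commute flip: Compl_eq_Diff_UNIV)
  also have "\<dots> = emeasure (distr \<gamma> borel snd) UNIV"
    using assms(2) sp by (simp add: mass_def emeasure_distr[OF snd])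
  also have "\<dots> = emeasure (distr \<gamma> borel snd) A + emeasure (distr \<gamma> borel snd) (- A)"
    using A by (simp add: plus_emeasure Compl_eq_Diff_UNIV)
  also have "\<dots> \<le> emeasure (distr \<gamma> borel snd) A + emeasure \<nu> (- A)"
    by (intro add_left_mono le')
  finally have "emeasure \<nu> A + emeasure \<nu> (- A) \<le> emeasure (distr \<gamma> borel snd) A + emeasure \<nu> (- A)" .
  moreover have "emeasure \<nu> (- A) \<noteq> \<infinity>"
    using assms(3) emeasure_space[of \<nu> "- A"] by (auto simp: mass_def top_unique)
  ultimately have "emeasure \<nu> A \<le> emeasure (distr \<gamma> borel snd) A"
    by (simp add: add.commute[of _ "emeasure \<nu> (- A)"] ennreal_add_left_cancel_le)
  then show "emeasure (distr \<gamma> borel snd) A = emeasure \<nu> A" using le'[of A] by simp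
qed

lemma transport_cost_eq:
  "transport_cost \<gamma> = (\<integral>\<^sup>+z. ennreal ((norm (fst z - snd z))\<^sup>2) \<partial>\<gamma>)"
  by (simp add: transport_cost_def split_beta')

lemma borel_measurable_sq_dist_map:
  fixes S :: "'b::second_countable_topology \<Rightarrow> 'a::euclidean_space"
  assumes [measurable]: "S \<in> borel_measurable borel" and "sets \<gamma> = sets borel"
  shows "(\<lambda>z. ennreal ((norm (fst z - S (snd z)))\<^sup>2)) \<in> borel_measurable \<gamma>"
proof -
  have "(\<lambda>z. ennreal ((norm (fst z - S (snd z)))\<^sup>2)) \<in> borel_measurable (borel \<Otimes>\<^sub>M borel)" by measurable
  then show ?thesis by (simp add: borel_prod measurable_cong_sets[OF assms(2) refl])
qed

text \<open>The pairs \<open>(x k, y k)\<close> are glued so that all \<open>y k\<close> lie in one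
  cell, and \<sigma> is the law of the \<open>x k\<close>. Replacing every \<open>y k\<close> by the
  single point \<open>y j\<close> costs only terms in \<delta>, after which the variance identity
  splits the cost into the spread and the distance of the average to \<open>y j\<close>; the latter
  bounds the distance of \<open>\<gamma> j\<close> to a graph. One \<sigma> serves all
  \<open>j\<close>; only \<open>S\<close> depends on \<open>j\<close>.\<close>

lemma glue_partial_couplings:
  fixes \<gamma> :: "'N::finite \<Rightarrow> ((real^'n) \<times> (real^'n)) measure"
  assumes \<gamma>: "\<And>j. \<gamma> j \<in> partial_couplings (\<mu> j) \<nu>" "\<And>j. mass (\<gamma> j) = ennreal m"
    and \<nu>: "sets \<nu> = sets borel" "mass \<nu> = ennreal m"
    and "0 < \<delta>" "0 \<le> m"
  obtains \<sigma> where "\<sigma> \<in> multi_partial_couplings \<mu>" "mass \<sigma> = ennreal m"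
    "\<And>j. \<exists>S\<in>borel_measurable borel.
        (\<integral>\<^sup>+x. ennreal (spread x) \<partial>\<sigma>)
          + ennreal (1 / real CARD('N)) * (\<integral>\<^sup>+z. ennreal ((norm (fst z - S (snd z)))\<^sup>2) \<partial>\<gamma> j)
        \<le> ennreal (1 + \<delta>) * (\<Sum>k\<in>UNIV. transport_cost (\<gamma> k)) + ennreal ((\<delta> + \<delta>\<^sup>2) * (real CARD('N) * m))"
proof -
  let ?N = "real CARD('N)"
  obtain idx :: "real^'n \<Rightarrow> nat" where idx[measurable]: "idx \<in> borel \<rightarrow>\<^sub>M count_space UNIV"
    and close: "\<And>x y. idx x = idx y \<Longrightarrow> dist x y < \<delta>"
    using exists_small_diameter_index[OF \<open>0 < \<delta>\<close>] by blast
  have s\<gamma>[measurable_cong]: "sets (\<gamma> j) = sets borel" for j using \<gamma>(1) by (auto simp: partial_couplings_def)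
  have snd\<gamma>: "distr (\<gamma> j) borel snd = \<nu>" for j
    by (rule partial_coupling_snd_eq[OF \<gamma>(1)]) (auto simp: \<gamma> \<nu>)
  have "distr (\<gamma> j) (count_space UNIV) (\<lambda>z. idx (snd z)) = distr \<nu> (count_space UNIV) idx" for j
    unfolding snd\<gamma>[of j, symmetric] by (subst distr_distr) (auto simp: comp_def)
  moreover have "finite_measure (distr \<nu> (count_space UNIV) idx)"
  proof (rule finite_measure.finite_measure_distr)
    show "finite_measure \<nu>" using \<nu>(2) by (intro finite_measureI) (simp add: mass_def)
  qed (use \<nu>(1) in \<open>simp cong: measurable_cong_sets\<close>)
  ultimately obtain \<tau> :: "('N \<Rightarrow> (real^'n) \<times> (real^'n)) measure" where
    s\<tau>[measurable_cong]: "sets \<tau> = sets (Pi\<^sub>M UNIV (\<lambda>_. borel))"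
    and comp: "\<And>j. distr \<tau> borel (\<lambda>\<omega>. \<omega> j) = \<gamma> j"
    and AE: "AE \<omega> in \<tau>. \<forall>j k. idx (snd (\<omega> j)) = idx (snd (\<omega> k))"
    and sec: "\<And>F j. F \<in> borel_measurable (Pi\<^sub>M UNIV (\<lambda>_. borel)) \<Longrightarrow>
       \<exists>w :: nat \<Rightarrow> 'N \<Rightarrow> (real^'n) \<times> (real^'n).
         (\<integral>\<^sup>+z. F ((w (idx (snd z)))(j := z)) \<partial>\<gamma> j) \<le> (\<integral>\<^sup>+\<omega>. F \<omega> \<partial>\<tau>)"
    using glue_conditionally_independent[of \<gamma> "\<lambda>z. idx (snd z)" "distr \<nu> (count_space UNIV) idx", OF s\<gamma>]
    by auto
  have proj[measurable]: "(\<lambda>\<omega>. \<omega> j) \<in> \<tau> \<rightarrow>\<^sub>M borel" for j :: 'N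
    by measurable
  define X where "X \<omega> = (\<chi> k. fst (\<omega> k))" for \<omega> :: "'N \<Rightarrow> (real^'n) \<times> (real^'n)"
  have X0[measurable]: "X \<in> borel_measurable (Pi\<^sub>M UNIV (\<lambda>_. borel))" unfolding X_def by measurable
  have X[measurable]: "X \<in> borel_measurable \<tau>" by measurable
  define \<sigma> where "\<sigma> = distr \<tau> borel X"
  have int\<gamma>: "(\<integral>\<^sup>+\<omega>. f (\<omega> k) \<partial>\<tau>) = (\<integral>\<^sup>+z. f z \<partial>\<gamma> k)" if "f \<in> borel_measurable borel" for f k
    unfolding comp[of k, symmetric] by (rule nn_integral_distr[symmetric]) (auto intro: that proj)
  have mass\<tau>: "emeasure \<tau> (space \<tau>) = ennreal m"
    using int\<gamma>[of "\<lambda>_. 1" undefined] \<gamma>(2)[of undefined] by (simp add: mass_def)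
  have "distr \<sigma> borel (\<lambda>x. x $ j) \<le> \<mu> j" for j
  proof -
    have "distr \<sigma> borel (\<lambda>x. x $ j) = distr \<tau> borel (\<lambda>\<omega>. fst (\<omega> j))"
      unfolding \<sigma>_def by (subst distr_distr) (auto simp: comp_def X_def)
    also have "\<dots> = distr (\<gamma> j) borel fst"
      unfolding comp[of j, symmetric] by (subst distr_distr) (auto simp: comp_def)
    finally show ?thesis using \<gamma>(1)[of j] by (simp add: partial_couplings_def)
  qed
  then have \<sigma>: "\<sigma> \<in> multi_partial_couplings \<mu>"
    by (simp add: multi_partial_couplings_def \<sigma>_def)
  have mass\<sigma>: "mass \<sigma> = ennreal m"
    using emeasure_distr[OF X, of UNIV] by (simp add: mass_def \<sigma>_def mass\<tau>)
  have "\<exists>S\<in>borel_measurable borel.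
        (\<integral>\<^sup>+x. ennreal (spread x) \<partial>\<sigma>)
          + ennreal (1 / ?N) * (\<integral>\<^sup>+z. ennreal ((norm (fst z - S (snd z)))\<^sup>2) \<partial>\<gamma> j)
        \<le> ennreal (1 + \<delta>) * (\<Sum>k\<in>UNIV. transport_cost (\<gamma> k)) + ennreal ((\<delta> + \<delta>\<^sup>2) * (?N * m))" for j
  proof -
    \<comment> \<open>The part of the cost that the variance identity leaves besides the spread,
      with \<open>snd (\<omega> j)\<close> as the common reference point.\<close>
    define F where "F \<omega> = ennreal (?N * (norm (average (X \<omega>) - snd (\<omega> j)))\<^sup>2)" for \<omega>
    have F[measurable]: "F \<in> borel_measurable (Pi\<^sub>M UNIV (\<lambda>_. borel))" unfolding F_def by measurable
    obtain w where w: "(\<integral>\<^sup>+z. F ((w (idx (snd z)))(j := z)) \<partial>\<gamma> j) \<le> (\<integral>\<^sup>+\<omega>. F \<omega> \<partial>\<tau>)"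
      using sec[OF F] by blast
    \<comment> \<open>The value of the \<open>j\<close>-th point for which the average is exactly
      \<open>y\<close> while the others are frozen. Hence the average deviates from \<open>y\<close>
      by \<open>1 / ?N\<close> times the deviation from \<open>S y\<close>, and the factor
      \<open>?N\<close> in \<open>F\<close> becomes \<open>1 / ?N\<close>.\<close>
    define S where "S y = ?N *\<^sub>R y - (\<Sum>k\<in>UNIV - {j}. fst (w (idx y) k))" for y
    have S[measurable]: "S \<in> borel_measurable borel"
    proof -
      have "(\<lambda>y. (\<Sum>k\<in>UNIV - {j}. fst (w (idx y) k))) \<in> borel_measurable borel"
        by (rule measurable_compose[OF idx]) simp
      then show ?thesis unfolding S_def by measurable
    qed
    have FS: "F ((w (idx (snd z)))(j := z)) = ennreal (1 / ?N) * ennreal ((norm (fst z - S (snd z)))\<^sup>2)" for z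
    proof -
      let ?r = "\<Sum>k\<in>UNIV - {j}. fst (w (idx (snd z)) k)"
      have "(\<Sum>k\<in>UNIV. X ((w (idx (snd z)))(j := z)) $ k) = fst z + ?r"
        by (subst sum.remove[of _ j]) (auto simp: X_def intro!: sum.cong)
      then have "average (X ((w (idx (snd z)))(j := z))) - snd z = (1 / ?N) *\<^sub>R (fst z - S (snd z))"
        by (simp add: average_def S_def algebra_simps)
      then have "norm (average (X ((w (idx (snd z)))(j := z))) - snd z) = 1 / ?N * norm (fst z - S (snd z))"
        by (simp only: norm_scaleR) simp
      then show ?thesis
        by (simp add: F_def ennreal_mult[symmetric] power_divide) (simp add: power2_eq_square)
    qed
    have "(\<integral>\<^sup>+x. ennreal (spread x) \<partial>\<sigma>)
        + ennreal (1 / ?N) * (\<integral>\<^sup>+z. ennreal ((norm (fst z - S (snd z)))\<^sup>2) \<partial>\<gamma> j)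
        = (\<integral>\<^sup>+\<omega>. ennreal (spread (X \<omega>)) \<partial>\<tau>) + (\<integral>\<^sup>+z. F ((w (idx (snd z)))(j := z)) \<partial>\<gamma> j)"
    proof -
      note borel_measurable_sq_dist_map[OF S s\<gamma>[of j]]
      then show ?thesis unfolding FS \<sigma>_def by (simp add: nn_integral_cmult nn_integral_distr)
    qed
    also have "\<dots> \<le> (\<integral>\<^sup>+\<omega>. ennreal (spread (X \<omega>)) \<partial>\<tau>) + (\<integral>\<^sup>+\<omega>. F \<omega> \<partial>\<tau>)"
      using w by (intro add_left_mono)
    also have "\<dots> = (\<integral>\<^sup>+\<omega>. ennreal (spread (X \<omega>)) + F \<omega> \<partial>\<tau>)"
      by (rule nn_integral_add[symmetric]) auto
    also have "\<dots> \<le> (\<integral>\<^sup>+\<omega>. ennreal (1 + \<delta>) * (\<Sum>k\<in>UNIV. ennreal ((norm (fst (\<omega> k) - snd (\<omega> k)))\<^sup>2))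
        + ennreal ((\<delta> + \<delta>\<^sup>2) * ?N) \<partial>\<tau>)"
    proof (rule nn_integral_mono_AE, rule AE_mp[OF AE], intro AE_I2 impI)
      fix \<omega> :: "'N \<Rightarrow> (real^'n) \<times> (real^'n)"
      assume eq: "\<forall>j k. idx (snd (\<omega> j)) = idx (snd (\<omega> k))"
      have "spread (X \<omega>) + ?N * (norm (average (X \<omega>) - snd (\<omega> j)))\<^sup>2
          = (\<Sum>k\<in>UNIV. (norm (fst (\<omega> k) - snd (\<omega> j)))\<^sup>2)"
        by (subst sum_dist_sq_eq_spread[symmetric]) (simp add: X_def)
      \<comment> \<open>The reference point moves from \<open>snd (\<omega> j)\<close> to
        \<open>snd (\<omega> k)\<close>, less than \<delta> away; Young's inequality charges
        \<open>(1 + 1 / \<delta>) * \<delta>\<^sup>2\<close>, that is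
        \<open>\<delta> + \<delta>\<^sup>2\<close>.\<close>
      also have "\<dots> \<le> (\<Sum>k\<in>UNIV. (1 + \<delta>) * (norm (fst (\<omega> k) - snd (\<omega> k)))\<^sup>2 + (\<delta> + \<delta>\<^sup>2))"
      proof (rule sum_mono)
        fix k
        have "norm (snd (\<omega> k) - snd (\<omega> j)) < \<delta>" using close eq by (metis dist_norm)
        then have "(norm (snd (\<omega> k) - snd (\<omega> j)))\<^sup>2 \<le> \<delta>\<^sup>2" by (intro power_mono) auto
        then have "(1 + 1 / \<delta>) * (norm (snd (\<omega> k) - snd (\<omega> j)))\<^sup>2 \<le> (1 + 1 / \<delta>) * \<delta>\<^sup>2"
          using \<open>0 < \<delta>\<close> by (intro mult_left_mono) auto
        also have "\<dots> = \<delta> + \<delta>\<^sup>2" using \<open>0 < \<delta>\<close> by (simp add: power2_eq_square field_simps)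
        finally show "(norm (fst (\<omega> k) - snd (\<omega> j)))\<^sup>2 \<le> (1 + \<delta>) * (norm (fst (\<omega> k) - snd (\<omega> k)))\<^sup>2 + (\<delta> + \<delta>\<^sup>2)"
          using norm_add_sq_le[OF \<open>0 < \<delta>\<close>, of "fst (\<omega> k) - snd (\<omega> k)" "snd (\<omega> k) - snd (\<omega> j)"] by simp
      qed
      also have "\<dots> = (1 + \<delta>) * (\<Sum>k\<in>UNIV. (norm (fst (\<omega> k) - snd (\<omega> k)))\<^sup>2) + (\<delta> + \<delta>\<^sup>2) * ?N"
        by (simp add: sum.distrib sum_distrib_left)
      finally show "ennreal (spread (X \<omega>)) + F \<omega> \<le>
          ennreal (1 + \<delta>) * (\<Sum>k\<in>UNIV. ennreal ((norm (fst (\<omega> k) - snd (\<omega> k)))\<^sup>2)) + ennreal ((\<delta> + \<delta>\<^sup>2) * ?N)"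
        using \<open>0 < \<delta>\<close> by (simp add: F_def sum_ennreal sum_nonneg spread_nonneg flip: ennreal_plus ennreal_mult)
    qed
    also have "\<dots> = ennreal (1 + \<delta>) * (\<Sum>k\<in>UNIV. transport_cost (\<gamma> k)) + ennreal ((\<delta> + \<delta>\<^sup>2) * ?N) * ennreal m"
    proof -
      have "(\<integral>\<^sup>+\<omega>. ennreal ((norm (fst (\<omega> k) - snd (\<omega> k)))\<^sup>2) \<partial>\<tau>) = transport_cost (\<gamma> k)" for k
        unfolding transport_cost_eq by (rule int\<gamma>) measurable
      moreover have m: "(\<lambda>\<omega>. ennreal ((norm (fst (\<omega> k) - snd (\<omega> k)))\<^sup>2)) \<in> borel_measurable \<tau>" for k
        using borel_measurable_sq_dist_map[of "\<lambda>y. y" borel]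
        by (rule measurable_compose[OF proj]) auto
      moreover have "(\<lambda>\<omega>. \<Sum>k\<in>UNIV. ennreal ((norm (fst (\<omega> k) - snd (\<omega> k)))\<^sup>2)) \<in> borel_measurable \<tau>"
        by (rule borel_measurable_sum) (rule m)
      ultimately show ?thesis
        by (simp add: nn_integral_add nn_integral_cmult nn_integral_sum mass\<tau> del: sum_ennreal)
    qed
    finally show ?thesis using S \<open>0 < \<delta>\<close> \<open>0 \<le> m\<close>
      by (intro bexI[of _ S]) (auto simp: ennreal_mult[symmetric] mult.assoc)
  qed
  then show thesis using that[OF \<sigma> mass\<sigma>] by blast
qed

section \<open>Comparison of the two problems\<close>

text \<open>Together with \<open>exists_partial_coupling\<close> this makes \<open>MK2\<close>
  finite, so that it can be cancelled in inequalities between extended reals.\<close>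

lemma transport_cost_le_second_moments:
  assumes "\<gamma> \<in> partial_couplings \<mu> \<nu>" "sets \<mu> = sets borel" "sets \<nu> = sets borel"
  shows "transport_cost \<gamma> \<le> 2 * second_moment \<mu> + 2 * second_moment \<nu>"
proof -
  have s[measurable_cong]: "sets \<gamma> = sets borel" and le: "distr \<gamma> borel fst \<le> \<mu>" "distr \<gamma> borel snd \<le> \<nu>"
    using assms(1) by (auto simp: partial_couplings_def)
  have m: "fst \<in> borel_measurable \<gamma>" "snd \<in> borel_measurable \<gamma>" by measurable
  have "transport_cost \<gamma> \<le> (\<integral>\<^sup>+z. 2 * ennreal ((norm (fst z))\<^sup>2) + 2 * ennreal ((norm (snd z))\<^sup>2) \<partial>\<gamma>)"
    unfolding transport_cost_eq
  proof (rule nn_integral_mono)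
    fix z :: "(real, 'a) vec \<times> (real, 'a) vec"
    have "(norm (fst z - snd z))\<^sup>2 \<le> 2 * (norm (fst z))\<^sup>2 + 2 * (norm (snd z))\<^sup>2"
      using norm_add_sq_le[of 1 "fst z" "- snd z"] by simp
    then have "ennreal ((norm (fst z - snd z))\<^sup>2) \<le> ennreal (2 * (norm (fst z))\<^sup>2 + 2 * (norm (snd z))\<^sup>2)"
      by (rule ennreal_leI)
    then show "ennreal ((norm (fst z - snd z))\<^sup>2) \<le> 2 * ennreal ((norm (fst z))\<^sup>2) + 2 * ennreal ((norm (snd z))\<^sup>2)"
      by (simp add: ennreal_mult)
  qed
  also have "\<dots> = 2 * second_moment (distr \<gamma> borel fst) + 2 * second_moment (distr \<gamma> borel snd)"
    using m by (simp add: second_moment_def nn_integral_distr nn_integral_add nn_integral_cmult)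
  also have "\<dots> \<le> 2 * second_moment \<mu> + 2 * second_moment \<nu>"
    using le assms(2,3) unfolding second_moment_def
    by (intro add_mono mult_left_mono nn_integral_mono_measure) auto
  finally show ?thesis .
qed

text \<open>The product measure divided by the mass of \<mu>: its first marginal is \<mu> scaled by
  \<open>m / mass \<mu>\<close>, a factor of at most 1, and its second marginal is \<nu>.\<close>

lemma exists_partial_coupling:
  assumes "sets \<mu> = sets borel" "sets \<nu> = sets borel" "mass \<mu> < \<infinity>" "mass \<nu> = ennreal m"
    "0 < m" "ennreal m \<le> mass \<mu>"
  shows "\<exists>\<gamma>\<in>partial_couplings \<mu> \<nu>. mass \<gamma> = ennreal m"
proof -
  note [measurable_cong] = assms(1,2)
  define c where "c = inverse (mass \<mu>)"
  have M: "mass \<mu> \<noteq> 0" using assms(5,6) by auto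
  then have c: "c * mass \<mu> = 1"
    using assms(3) ennreal_divide_self[of "mass \<mu>"] by (simp add: c_def divide_ennreal_def mult.commute)
  have sp: "space \<mu> = UNIV" "space \<nu> = UNIV" 
    using sets_eq_imp_space_eq[OF assms(1)] sets_eq_imp_space_eq[OF assms(2)] by simp_all
  interpret \<nu>: finite_measure \<nu> using assms(4) by (intro finite_measureI) (simp add: mass_def)
  define \<gamma> where "\<gamma> = scale_measure c (\<mu> \<Otimes>\<^sub>M \<nu>)"
  have sp\<gamma>: "space \<gamma> = UNIV" by (simp add: \<gamma>_def space_scale_measure space_pair_measure sp)
  have s: "sets \<gamma> = sets borel"
    unfolding \<gamma>_def by (simp add: borel_prod[symmetric]) (rule sets_pair_measure_cong[OF assms(1,2)])
  note [measurable_cong] = s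
  have "emeasure (distr \<gamma> borel fst) A \<le> emeasure \<mu> A" if A: "A \<in> sets borel" for A
  proof -
    have "emeasure (distr \<gamma> borel fst) A = c * (emeasure \<mu> A * ennreal m)"
      using A assms(1,2,4) by (subst emeasure_distr)
        (auto simp: sp\<gamma> \<gamma>_def vimage_fst \<nu>.emeasure_pair_measure_Times mass_def sp)
    also have "\<dots> \<le> c * (emeasure \<mu> A * mass \<mu>)" using assms(6) by (intro mult_left_mono) auto
    also have "\<dots> = emeasure \<mu> A * (c * mass \<mu>)" by (rule mult.left_commute)
    also have "\<dots> = emeasure \<mu> A" using c by simp
    finally show ?thesis .
  qed
  moreover have "emeasure (distr \<gamma> borel snd) A = emeasure \<nu> A" if A: "A \<in> sets borel" for A
  proof -
    have "emeasure (distr \<gamma> borel snd) A = c * (mass \<mu> * emeasure \<nu> A)"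
      using A assms(1,2) by (subst emeasure_distr)
        (auto simp: sp\<gamma> \<gamma>_def vimage_snd \<nu>.emeasure_pair_measure_Times mass_def sp)
    then show ?thesis using c by (simp add: mult.assoc[symmetric])
  qed
  ultimately have "\<gamma> \<in> partial_couplings \<mu> \<nu>"
    using s assms(1,2) by (simp add: partial_couplings_def le_measure)
  moreover have "mass \<gamma> = ennreal m"
  proof -
    have "mass \<gamma> = c * (mass \<mu> * mass \<nu>)"
      using \<nu>.emeasure_pair_measure_Times[of UNIV \<mu> UNIV] assms(1,2)
      by (simp add: mass_def sp sp\<gamma>) (simp add: \<gamma>_def)
    then show ?thesis using c assms(4) by (simp add: mult.assoc[symmetric])
  qed
  ultimately show ?thesis by blast
qed

locale barycenter_problem =
  fixes \<mu> :: "'N::finite \<Rightarrow> (real^'n) measure" and m :: real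
  assumes borel2_\<mu>: "\<And>j. borel_measure2 (\<mu> j)"
    and finite_mass_\<mu>: "\<And>j. mass (\<mu> j) < \<infinity>"
    and m_pos: "0 < m" and m_le_mass: "\<And>j. ennreal m \<le> mass (\<mu> j)"
begin

abbreviation coupling :: "'N \<Rightarrow> (real^'n) measure \<Rightarrow> ((real^'n) \<times> (real^'n)) measure \<Rightarrow> bool" where
  "coupling j \<nu> \<gamma> \<equiv> \<gamma> \<in> partial_couplings (\<mu> j) \<nu> \<and> mass \<gamma> = ennreal m"

abbreviation multi_coupling :: "(real^'n^'N) measure \<Rightarrow> bool" where
  "multi_coupling \<sigma> \<equiv> \<sigma> \<in> multi_partial_couplings \<mu> \<and> mass \<sigma> = ennreal m"

abbreviation BC_cost :: "(real^'n) measure \<Rightarrow> ennreal" where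
  "BC_cost \<nu> \<equiv> (\<Sum>j\<in>UNIV. MK2 m (\<mu> j) \<nu>)"

text \<open>\<open>multi_cost\<close> without its constant factor, so that it compares with
  \<open>BC_cost\<close> directly.\<close>

abbreviation spread_cost :: "(real^'n^'N) measure \<Rightarrow> ennreal" where
  "spread_cost \<sigma> \<equiv> (\<integral>\<^sup>+x. ennreal (spread x) \<partial>\<sigma>)"

section \<open>Finiteness, near-optimal couplings and the two inequalities between the costs\<close>

lemma sets_\<mu>: "sets (\<mu> j) = sets borel"
  using borel2_\<mu>[of j] by (simp add: borel_measure2_def)

lemma sets_coupling: "coupling j \<nu> \<gamma> \<Longrightarrow> sets \<gamma> = sets borel"
  by (simp add: partial_couplings_def)

lemma measures_of_massD:
  assumes "\<nu> \<in> measures_of_mass m"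
  shows "sets \<nu> = sets borel" "second_moment \<nu> < \<infinity>" "mass \<nu> = ennreal m"
  using assms by (auto simp: measures_of_mass_def borel_measure2_def)

lemma coupling_snd:
  assumes "\<nu> \<in> measures_of_mass m" "coupling j \<nu> \<gamma>"
  shows "distr \<gamma> borel snd = \<nu>"
  using assms measures_of_massD[OF assms(1)]
  by (intro partial_coupling_snd_eq[of \<gamma> "\<mu> j"]) auto

lemma MK2_le: "coupling j \<nu> \<gamma> \<Longrightarrow> MK2 m (\<mu> j) \<nu> \<le> transport_cost \<gamma>"
  unfolding MK2_def by (rule INF_lower) auto

lemma MK2_finite:
  assumes "\<nu> \<in> measures_of_mass m"
  shows "MK2 m (\<mu> j) \<nu> < \<infinity>"
proof -
  note \<nu> = measures_of_massD[OF assms]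
  obtain \<gamma> where \<gamma>: "coupling j \<nu> \<gamma>"
    using exists_partial_coupling[OF sets_\<mu> \<nu>(1) finite_mass_\<mu> \<nu>(3) m_pos m_le_mass] by blast
  have "MK2 m (\<mu> j) \<nu> \<le> transport_cost \<gamma>" by (rule MK2_le[OF \<gamma>])
  also have "\<dots> \<le> 2 * second_moment (\<mu> j) + 2 * second_moment \<nu>"
    using \<gamma> by (intro transport_cost_le_second_moments) (auto simp: sets_\<mu> \<nu>)
  also have "\<dots> < \<infinity>" using \<nu>(2) borel2_\<mu>[of j] by (simp add: borel_measure2_def ennreal_mult_less_top)
  finally show ?thesis .
qed

lemma BC_cost_finite:
  assumes "\<nu> \<in> measures_of_mass m"
  shows "BC_cost \<nu> < \<infinity>"
  using MK2_finite[OF assms] by (simp add: less_top[symmetric])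

text \<open>Stands in for an optimal coupling until \<open>exists_optimal_map\<close> shows that the
  infimum is attained at an optimal \<nu>. Finiteness of the infimum makes the excess \<epsilon> a
  strict one.\<close>

lemma exists_near_optimal:
  assumes "\<nu> \<in> measures_of_mass m" "0 < \<epsilon>"
  shows "\<exists>\<gamma>. coupling j \<nu> \<gamma> \<and> transport_cost \<gamma> \<le> MK2 m (\<mu> j) \<nu> + ennreal \<epsilon>"
proof -
  have "MK2 m (\<mu> j) \<nu> < MK2 m (\<mu> j) \<nu> + ennreal \<epsilon>"
    using MK2_finite[OF assms(1), of j] assms(2)
    by (cases "MK2 m (\<mu> j) \<nu>") (auto simp: ennreal_less_iff simp flip: ennreal_plus)
  then show ?thesis
    unfolding MK2_def[of m "\<mu> j" \<nu>] INF_less_iff by (auto intro: less_imp_le)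
qed

lemma BC_optimal_iff:
  "BC_optimal m \<mu> \<nu> \<longleftrightarrow> \<nu> \<in> measures_of_mass m \<and> (\<forall>\<nu>'\<in>measures_of_mass m. BC_cost \<nu> \<le> BC_cost \<nu>')"
  by (auto simp: BC_optimal_def is_arg_min_linorder)

lemma MM_optimal_iff:
  "MM_optimal m \<mu> \<sigma> \<longleftrightarrow> multi_coupling \<sigma> \<and> (\<forall>\<sigma>'. multi_coupling \<sigma>' \<longrightarrow> spread_cost \<sigma> \<le> spread_cost \<sigma>')"
proof -
  have "multi_cost \<sigma> \<le> multi_cost \<sigma>' \<longleftrightarrow> spread_cost \<sigma> \<le> spread_cost \<sigma>'"
    if "multi_coupling \<sigma>" "multi_coupling \<sigma>'" for \<sigma> \<sigma>'
    using that by (simp add: multi_partial_couplings_def multi_cost_eq_spread ennreal_mult_le_mult_iff)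
  then show ?thesis unfolding MM_optimal_def is_arg_min_linorder by blast
qed

text \<open>The joint law of \<open>x $ j\<close> and \<open>average x\<close> is an admissible
  coupling of \<open>\<mu> j\<close> with the law of the average, and the costs of these couplings
  add up to the spread. This is the easy inequality between the two problems.\<close>

lemma multi_coupling_average:
  assumes "multi_coupling \<sigma>"
  defines "\<nu> \<equiv> distr \<sigma> borel average"
  defines "\<gamma> j \<equiv> distr \<sigma> borel (\<lambda>x. (x $ j, average x))"
  shows "\<nu> \<in> measures_of_mass m" and "coupling j \<nu> (\<gamma> j)"
    and "(\<Sum>j\<in>UNIV. transport_cost (\<gamma> j)) = spread_cost \<sigma>" and "BC_cost \<nu> \<le> spread_cost \<sigma>"
proof -
  have s: "sets \<sigma> = sets borel" and le: "\<And>j. distr \<sigma> borel (\<lambda>x. x $ j) \<le> \<mu> j"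
    using assms(1) by (auto simp: multi_partial_couplings_def)
  note [measurable_cong] = s
  have sp: "space \<sigma> = UNIV" using sets_eq_imp_space_eq[OF s] by simp
  have pair: "(\<lambda>x. (x $ j, average x)) \<in> \<sigma> \<rightarrow>\<^sub>M borel" for j
    by (simp add: borel_prod[symmetric])
  have mass: "mass (distr \<sigma> borel f) = ennreal m" if "f \<in> \<sigma> \<rightarrow>\<^sub>M borel" for f :: "_ \<Rightarrow> 'c::topological_space"
    using that assms(1) by (simp add: mass_def emeasure_distr)
  have cost: "transport_cost (\<gamma> j) = (\<integral>\<^sup>+x. ennreal ((norm (x $ j - average x))\<^sup>2) \<partial>\<sigma>)" for j
    unfolding transport_cost_eq \<gamma>_def by (subst nn_integral_distr[OF pair]) auto
  have "second_moment \<nu> \<le> (\<integral>\<^sup>+x. ennreal (\<Sum>j\<in>UNIV. (norm (x $ j))\<^sup>2) \<partial>\<sigma>)"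
  proof -
    \<comment> \<open>The variance identity at \<open>y = 0\<close>; the squared norm of the average
      appears there with a factor \<open>N\<close>, which is at least 1.\<close>
    have "(norm (average x))\<^sup>2 \<le> (\<Sum>j\<in>UNIV. (norm (x $ j))\<^sup>2)" for x :: "real^'n^'N"
    proof -
      have "(norm (average x))\<^sup>2 \<le> real CARD('N) * (norm (average x))\<^sup>2"
        using mult_right_mono[of 1 "real CARD('N)" "(norm (average x))\<^sup>2"]
        by (simp add: Suc_le_eq)
      then show ?thesis using sum_dist_sq_eq_spread[of x 0] spread_nonneg[of x] by simp
    qed
    then show ?thesis
      unfolding second_moment_def \<nu>_def by (subst nn_integral_distr) (auto intro!: nn_integral_mono ennreal_leI)
  qed
  also have "\<dots> = (\<integral>\<^sup>+x. (\<Sum>j\<in>UNIV. ennreal ((norm (x $ j))\<^sup>2)) \<partial>\<sigma>)"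
    by (simp add: sum_ennreal)
  also have "\<dots> = (\<Sum>j\<in>UNIV. \<integral>\<^sup>+x. ennreal ((norm (x $ j))\<^sup>2) \<partial>\<sigma>)"
    by (rule nn_integral_sum) measurable
  also have "\<dots> = (\<Sum>j\<in>UNIV. second_moment (distr \<sigma> borel (\<lambda>x. x $ j)))"
    by (simp add: second_moment_def nn_integral_distr)
  also have "\<dots> \<le> (\<Sum>j\<in>UNIV. second_moment (\<mu> j))"
    unfolding second_moment_def by (intro sum_mono nn_integral_mono_measure le) (simp add: sets_\<mu>)
  also have "\<dots> < \<infinity>" using borel2_\<mu> by (simp add: borel_measure2_def less_top[symmetric])
  finally show \<nu>: "\<nu> \<in> measures_of_mass m"
    by (simp add: measures_of_mass_def borel_measure2_def mass \<nu>_def)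
  show coup: "coupling j \<nu> (\<gamma> j)" for j
  proof -
    have "distr (\<gamma> j) borel fst = distr \<sigma> borel (\<lambda>x. x $ j)" "distr (\<gamma> j) borel snd = \<nu>"
      unfolding \<gamma>_def \<nu>_def by (simp_all add: distr_distr pair comp_def)
    then show ?thesis using le[of j] mass[OF pair[of j]] by (simp add: partial_couplings_def \<gamma>_def)
  qed
  show sum: "(\<Sum>j\<in>UNIV. transport_cost (\<gamma> j)) = spread_cost \<sigma>"
  proof -
    have "spread_cost \<sigma> = (\<integral>\<^sup>+x. (\<Sum>j\<in>UNIV. ennreal ((norm (x $ j - average x))\<^sup>2)) \<partial>\<sigma>)"
      by (simp add: spread_def sum_ennreal)
    then show ?thesis by (simp add: cost nn_integral_sum del: sum_ennreal)
  qed
  show "BC_cost \<nu> \<le> spread_cost \<sigma>"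
    unfolding sum[symmetric] by (intro sum_mono MK2_le coup)
qed

text \<open>One parameter \<open>t\<close> is both the excess cost and the diameter of the cells. As
  \<open>t\<^sup>2 \<le> t\<close>, the product \<open>(1 + t) * (b + t)\<close> is at most
  \<open>b + t * (b + 2)\<close>, and the diameter error adds at most
  \<open>t * (2 * N * m)\<close>; together these give the stated bound.\<close>

lemma glue_near_optimal:
  assumes \<nu>: "\<nu> \<in> measures_of_mass m" and \<gamma>: "\<And>j. coupling j \<nu> (\<gamma> j)"
    and cost: "(\<Sum>j\<in>UNIV. transport_cost (\<gamma> j)) \<le> ennreal (b + t)"
    and "0 \<le> b" "0 < t" "t \<le> 1"
  obtains \<sigma> where "multi_coupling \<sigma>"
    "\<And>j. \<exists>S\<in>borel_measurable borel.
        spread_cost \<sigma> + ennreal (1 / real CARD('N)) * (\<integral>\<^sup>+z. ennreal ((norm (fst z - S (snd z)))\<^sup>2) \<partial>\<gamma> j)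
        \<le> ennreal (b + t * (b + 2 + 2 * real CARD('N) * m))"
proof -
  let ?N = "real CARD('N)"
  note \<nu>' = measures_of_massD[OF \<nu>]
  note glue = glue_partial_couplings[of \<gamma> \<mu> \<nu> m t,
      OF conjunct1[OF \<gamma>] conjunct2[OF \<gamma>] \<nu>'(1,3) \<open>0 < t\<close> less_imp_le[OF m_pos]]
  have "ennreal (1 + t) * (\<Sum>k\<in>UNIV. transport_cost (\<gamma> k)) + ennreal ((t + t\<^sup>2) * (?N * m))
    \<le> ennreal (1 + t) * ennreal (b + t) + ennreal ((t + t\<^sup>2) * (?N * m))"
    by (intro add_right_mono mult_left_mono cost) simp
  also have "\<dots> = ennreal ((1 + t) * (b + t) + (t + t\<^sup>2) * (?N * m))"
    using assms(4-6) m_pos by (simp flip: ennreal_mult ennreal_plus)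
  also have "\<dots> \<le> ennreal (b + t * (b + 2 + 2 * ?N * m))"
  proof (rule ennreal_leI)
    have sq: "t\<^sup>2 \<le> t" using assms(5,6) by (simp add: power2_eq_square mult_left_le)
    then have "t\<^sup>2 * (?N * m) \<le> t * (?N * m)" using m_pos by (intro mult_right_mono) auto
    with sq show "(1 + t) * (b + t) + (t + t\<^sup>2) * (?N * m) \<le> b + t * (b + 2 + 2 * ?N * m)"
      by (simp add: algebra_simps power2_eq_square)
  qed
  finally have le: "ennreal (1 + t) * (\<Sum>k\<in>UNIV. transport_cost (\<gamma> k)) + ennreal ((t + t\<^sup>2) * (?N * m))
    \<le> ennreal (b + t * (b + 2 + 2 * ?N * m))" .
  show thesis
  proof (rule glue)
    fix \<sigma> assume \<sigma>: "\<sigma> \<in> multi_partial_couplings \<mu>" "mass \<sigma> = ennreal m"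
      and *: "\<exists>S\<in>borel_measurable borel.
        spread_cost \<sigma> + ennreal (1 / ?N) * (\<integral>\<^sup>+z. ennreal ((norm (fst z - S (snd z)))\<^sup>2) \<partial>\<gamma> j)
        \<le> ennreal (1 + t) * (\<Sum>k\<in>UNIV. transport_cost (\<gamma> k)) + ennreal ((t + t\<^sup>2) * (?N * m))" for j
    show thesis
    proof (rule that)
      show "multi_coupling \<sigma>" using \<sigma> by simp
      show "\<exists>S\<in>borel_measurable borel.
        spread_cost \<sigma> + ennreal (1 / ?N) * (\<integral>\<^sup>+z. ennreal ((norm (fst z - S (snd z)))\<^sup>2) \<partial>\<gamma> j)
        \<le> ennreal (b + t * (b + 2 + 2 * ?N * m))" for j
        using *[of j] le by (blast intro: order_trans)
    qed
  qed
qed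

text \<open>The hard inequality between the two values: glue near-optimal couplings, drop the
  distance to the graph and let \<open>t\<close> tend to 0. An arbitrary lower bound
  \<open>D\<close> takes the place of the minimum, so no minimizer has to exist.\<close>

lemma spread_lower_bound_le_BC_cost:
  assumes D: "\<And>\<sigma>. multi_coupling \<sigma> \<Longrightarrow> D \<le> spread_cost \<sigma>" and \<nu>: "\<nu> \<in> measures_of_mass m"
  shows "D \<le> BC_cost \<nu>"
proof -
  let ?N = "real CARD('N)"
  obtain b where b: "BC_cost \<nu> = ennreal b" "0 \<le> b"
    using BC_cost_finite[OF \<nu>] by (cases "BC_cost \<nu>") auto
  define C where "C = b + 2 + 2 * ?N * m"
  have C: "0 < C" using b m_pos by (simp add: C_def add_pos_nonneg)
  have step: "D \<le> ennreal (b + t * C)" if t: "0 < t" "t \<le> 1" for t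
  proof -
    \<comment> \<open>Each of the \<open>N\<close> couplings may exceed its infimum by
      \<open>t / ?N\<close>, so that the total excess is \<open>t\<close>.\<close>
    have "\<exists>\<gamma>. coupling j \<nu> \<gamma> \<and> transport_cost \<gamma> \<le> MK2 m (\<mu> j) \<nu> + ennreal (t / ?N)" for j
      using t by (intro exists_near_optimal \<nu>) simp
    then obtain \<gamma> where \<gamma>: "\<And>j. coupling j \<nu> (\<gamma> j)"
      and cost: "\<And>j. transport_cost (\<gamma> j) \<le> MK2 m (\<mu> j) \<nu> + ennreal (t / ?N)" by metis
    have "(\<Sum>k\<in>UNIV. transport_cost (\<gamma> k)) \<le> (\<Sum>k\<in>UNIV. MK2 m (\<mu> k) \<nu> + ennreal (t / ?N))"
      by (intro sum_mono cost)
    also have "\<dots> = ennreal (b + t)"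
      using b t by (simp add: sum.distrib ennreal_of_nat_eq_real_of_nat flip: ennreal_mult)
    finally have total: "(\<Sum>k\<in>UNIV. transport_cost (\<gamma> k)) \<le> ennreal (b + t)" .
    obtain \<sigma> where \<sigma>: "multi_coupling \<sigma>" and "\<exists>S\<in>borel_measurable borel. spread_cost \<sigma>
        + ennreal (1 / ?N) * (\<integral>\<^sup>+z. ennreal ((norm (fst z - S (snd z)))\<^sup>2) \<partial>\<gamma> undefined) \<le> ennreal (b + t * C)"
      unfolding C_def by (rule glue_near_optimal[OF \<nu> \<gamma> total b(2) t]) blast
    then have "spread_cost \<sigma> \<le> ennreal (b + t * C)" by (meson le_iff_add order_trans)
    then show ?thesis using D[OF \<sigma>] by simp
  qed
  show ?thesis
  proof (rule ennreal_le_epsilon)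
    fix e :: real assume "0 < e"
    define t where "t = min 1 (e / C)"
    have "t * C \<le> e" using C by (simp add: t_def min_def field_simps)
    have "D \<le> ennreal (b + t * C)" using C \<open>0 < e\<close> by (intro step) (simp_all add: t_def)
    also have "\<dots> \<le> ennreal (b + e)" using \<open>t * C \<le> e\<close> by (intro ennreal_leI) simp
    finally show "D \<le> BC_cost \<nu> + ennreal e" using b \<open>0 < e\<close> by simp
  qed
qed

text \<open>The cost of the average is at most \<open>spread_cost \<sigma>\<close>, which is a lower
  bound for all spreads and therefore for every \<open>BC_cost\<close>.\<close>

lemma BC_optimal_average:
  assumes "MM_optimal m \<mu> \<sigma>"
  shows "BC_optimal m \<mu> (distr \<sigma> borel average)"
  using assms multi_coupling_average[of \<sigma>] spread_lower_bound_le_BC_cost[of "spread_cost \<sigma>"]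
  unfolding MM_optimal_iff BC_optimal_iff by (blast intro: order_trans)

end

section \<open>Concentration of near-optimal couplings\<close>

lemma two_mult_ennreal_half: "0 \<le> c \<Longrightarrow> 2 * ennreal (c / 2) = ennreal c"
  by (simp add: mult_2 flip: ennreal_plus)

text \<open>Half the sum of two measures, obtained as a mixture over a two-point space. The kernel
  of a monadic bind must consist of subprobabilities, so both measures are normalised and the
  weights \<open>c / 2\<close> restore the mass. The doubled form of the integral identity avoids
  division in \<open>ennreal\<close>.\<close>

lemma exists_midpoint_measure:
  fixes M0 M1 :: "'a measure"
  assumes "sets M1 = sets M0" "mass M0 = ennreal c" "mass M1 = ennreal c" "0 < c"
  obtains K where "sets K = sets M0"
    "\<And>f. f \<in> borel_measurable M0 \<Longrightarrow> 2 * (\<integral>\<^sup>+x. f x \<partial>K) = (\<integral>\<^sup>+x. f x \<partial>M0) + (\<integral>\<^sup>+x. f x \<partial>M1)"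
proof -
  have sp: "space M1 = space M0" using sets_eq_imp_space_eq[OF assms(1)] .
  have ne: "space M0 \<noteq> {}" using assms(2,4) by (auto simp: mass_def)
  define q where "q = point_measure (UNIV :: bool set) (\<lambda>_. ennreal (c / 2))"
  define \<kappa> where "\<kappa> b = scale_measure (ennreal (1 / c)) (if b then M0 else M1)" for b
  have c: "ennreal (1 / c) * ennreal c = 1" using assms(4) by (simp flip: ennreal_mult)
  have prob: "subprob_space (\<kappa> b)" for b
    by (rule subprob_spaceI)
      (use assms(2,3) c ne sp in \<open>auto simp: \<kappa>_def space_scale_measure mass_def\<close>)
  have sets\<kappa>: "sets (\<kappa> b) = sets M0" for b by (simp add: \<kappa>_def assms(1))
  have \<kappa>: "\<kappa> \<in> q \<rightarrow>\<^sub>M subprob_algebra M0"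
    by (simp add: q_def measurable_def space_point_measure sets_point_measure space_subprob_algebra prob sets\<kappa>)
  show thesis
  proof (rule that)
    show "sets (q \<bind> \<kappa>) = sets M0"
      by (rule sets_bind) (auto simp: sets\<kappa> q_def space_point_measure)
    fix f :: "'a \<Rightarrow> ennreal" assume f: "f \<in> borel_measurable M0"
    then have f1: "f \<in> borel_measurable M1" by (simp add: measurable_cong_sets[OF assms(1) refl])
    have h: "2 * (ennreal (c / 2) * (ennreal (1 / c) * a)) = a" for a
    proof -
      have "2 * (ennreal (c / 2) * (ennreal (1 / c) * a)) = (2 * ennreal (c / 2)) * ennreal (1 / c) * a"
        by (simp only: mult.assoc)
      also have "\<dots> = (ennreal (1 / c) * ennreal c) * a"
        using assms(4) by (simp only: two_mult_ennreal_half less_imp_le mult.commute)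
      finally show ?thesis by (simp only: c mult_1)
    qed
    have "(\<integral>\<^sup>+x. f x \<partial>(q \<bind> \<kappa>)) = (\<integral>\<^sup>+b. \<integral>\<^sup>+x. f x \<partial>\<kappa> b \<partial>q)"
      by (rule nn_integral_bind[OF f \<kappa>])
    also have "\<dots> = ennreal (c / 2) * (\<integral>\<^sup>+x. f x \<partial>\<kappa> True) + ennreal (c / 2) * (\<integral>\<^sup>+x. f x \<partial>\<kappa> False)"
      unfolding q_def by (subst nn_integral_point_measure_finite) (auto simp: UNIV_bool mult.commute)
    also have "\<dots> = ennreal (c / 2) * (ennreal (1 / c) * (\<integral>\<^sup>+x. f x \<partial>M0)) + ennreal (c / 2) * (ennreal (1 / c) * (\<integral>\<^sup>+x. f x \<partial>M1))"
      by (simp add: \<kappa>_def nn_integral_scale_measure[OF f] nn_integral_scale_measure[OF f1])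
    finally show "2 * (\<integral>\<^sup>+x. f x \<partial>(q \<bind> \<kappa>)) = (\<integral>\<^sup>+x. f x \<partial>M0) + (\<integral>\<^sup>+x. f x \<partial>M1)"
      by (simp only: distrib_left h)
  qed
qed

text \<open>Marginal bounds and mass depend affinely on the measure and survive averaging; they are
  recovered from the integral identity by testing with indicators.\<close>

lemma midpoint_partial_coupling:
  fixes \<gamma>0 \<gamma>1 :: "((real^'n) \<times> (real^'n)) measure"
  assumes "\<gamma>0 \<in> partial_couplings \<mu> \<nu>" "\<gamma>1 \<in> partial_couplings \<mu> \<nu>"
    and "mass \<gamma>0 = ennreal m" "mass \<gamma>1 = ennreal m" "0 < m"
    and "sets \<mu> = sets borel" "sets \<nu> = sets borel"
  obtains \<kappa> where "\<kappa> \<in> partial_couplings \<mu> \<nu>" "mass \<kappa> = ennreal m"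
    "\<And>f. f \<in> borel_measurable borel \<Longrightarrow> 2 * (\<integral>\<^sup>+x. f x \<partial>\<kappa>) = (\<integral>\<^sup>+x. f x \<partial>\<gamma>0) + (\<integral>\<^sup>+x. f x \<partial>\<gamma>1)"
proof -
  have s: "sets \<gamma>0 = sets borel" "sets \<gamma>1 = sets borel"
    using assms(1,2) by (auto simp: partial_couplings_def)
  have s10: "sets \<gamma>1 = sets \<gamma>0" using s by simp
  obtain \<kappa> where s\<kappa>: "sets \<kappa> = sets borel"
    and \<kappa>: "\<And>f. f \<in> borel_measurable borel \<Longrightarrow> 2 * (\<integral>\<^sup>+x. f x \<partial>\<kappa>) = (\<integral>\<^sup>+x. f x \<partial>\<gamma>0) + (\<integral>\<^sup>+x. f x \<partial>\<gamma>1)"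
    using exists_midpoint_measure[OF s10 assms(3,4,5)]
    unfolding s(1) measurable_cong_sets[OF s(1) refl] by metis
  have two: "a = b" if "2 * a = 2 * b" for a b :: ennreal using that by (simp add: ennreal_mult_cancel_left)
  have two_le: "a \<le> b" if "2 * a \<le> 2 * b" for a b :: ennreal using that by (simp add: ennreal_mult_le_mult_iff)
  have em: "2 * emeasure \<kappa> A = emeasure \<gamma>0 A + emeasure \<gamma>1 A" if "A \<in> sets borel" for A
    using \<kappa>[of "indicator A"] that by (simp add: s s\<kappa>)
  have marg: "distr \<kappa> borel p \<le> \<rho>"
    if p: "p \<in> borel_measurable borel" and le: "distr \<gamma>0 borel p \<le> \<rho>" "distr \<gamma>1 borel p \<le> \<rho>" and \<rho>: "sets \<rho> = sets borel"
    for p :: "_ \<Rightarrow> real^'n" and \<rho>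
  proof -
    have pm: "p \<in> borel_measurable \<gamma>" if "sets \<gamma> = sets borel" for \<gamma>
      using p by (simp add: measurable_cong_sets[OF that refl])
    have d: "emeasure (distr \<gamma> borel p) A = emeasure \<gamma> (p -` A)" if "sets \<gamma> = sets borel" "A \<in> sets borel" for \<gamma> A
      using sets_eq_imp_space_eq[OF that(1)] by (subst emeasure_distr[OF pm]) (auto simp: that)
    have "emeasure (distr \<kappa> borel p) A \<le> emeasure \<rho> A" if A: "A \<in> sets borel" for A
    proof (rule two_le)
      have pA: "p -` A \<in> sets borel" using measurable_sets[OF p A] by simp
      have "2 * emeasure (distr \<kappa> borel p) A = emeasure (distr \<gamma>0 borel p) A + emeasure (distr \<gamma>1 borel p) A"
        by (simp add: d s s\<kappa> A em pA)
      also have "\<dots> \<le> emeasure \<rho> A + emeasure \<rho> A"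
        using le \<rho> by (intro add_mono le_measureD3) auto
      finally show "2 * emeasure (distr \<kappa> borel p) A \<le> 2 * emeasure \<rho> A" by (simp add: mult_2)
    qed
    then show ?thesis using \<rho> by (simp add: le_measure)
  qed
  show thesis
  proof (rule that[OF _ _ \<kappa>])
    show "\<kappa> \<in> partial_couplings \<mu> \<nu>"
      using assms(1,2) s\<kappa> by (auto simp: partial_couplings_def intro!: marg assms(6,7))
    have "2 * mass \<kappa> = 2 * ennreal m"
      using em[of UNIV] assms(3,4) sets_eq_imp_space_eq[OF s(1)] sets_eq_imp_space_eq[OF s(2)] sets_eq_imp_space_eq[OF s\<kappa>]
      by (simp add: mass_def mult_2)
    then show "mass \<kappa> = ennreal m" by (rule two)
  qed
qed

text \<open>Outer regularity of the finite measure \<open>N\<close>. Open sets are the right test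
  class for limits of maps: if the limit lies in an open set, so do the late members of the
  sequence.\<close>

lemma le_measure_of_open:
  fixes M N :: "'a::polish_space measure"
  assumes "sets M = sets borel" "sets N = sets borel" "emeasure N (space N) \<noteq> \<infinity>"
    and "\<And>U. open U \<Longrightarrow> emeasure M U \<le> emeasure N U"
  shows "M \<le> N"
proof -
  have "emeasure M A \<le> emeasure N A" if A: "A \<in> sets borel" for A
  proof -
    have "emeasure M A \<le> emeasure N U" if "A \<subseteq> U" "open U" for U
    proof -
      have "emeasure M A \<le> emeasure M U" using that assms(1) by (intro emeasure_mono) auto
      then show ?thesis using assms(4)[OF that(2)] by simp
    qed
    then have "emeasure M A \<le> (INF U\<in>{U. A \<subseteq> U \<and> open U}. emeasure N U)"
      by (intro INF_greatest) auto
    then show ?thesis using outer_regular[OF assms(2,3), of A] A by simp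
  qed
  then show ?thesis using assms(1,2) by (simp add: le_measure)
qed

text \<open>With no slack in the finite total there is none in a single term. This turns optimality
  of a sum of costs into optimality of each coupling.\<close>

lemma sum_ennreal_eq_pointwise:
  fixes f g :: "'i \<Rightarrow> ennreal"
  assumes "finite I" "\<And>i. i \<in> I \<Longrightarrow> g i \<le> f i" "sum f I \<le> sum g I" "sum g I < \<infinity>" "i \<in> I"
  shows "f i = g i"
proof -
  have "f i + sum g (I - {i}) \<le> f i + sum f (I - {i})"
    using assms(2) by (intro add_left_mono sum_mono) auto
  also have "\<dots> \<le> g i + sum g (I - {i})"
    using assms(1,3,5) by (simp flip: sum.remove)
  finally have "sum g (I - {i}) + f i \<le> sum g (I - {i}) + g i" by (simp add: add.commute)
  moreover have "sum g (I - {i}) \<noteq> \<infinity>"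
    using assms(1,4) sum_mono2[of I "I - {i}" g] by (auto simp: top_unique)
  ultimately have "f i \<le> g i" by (simp add: ennreal_add_left_cancel_le)
  then show ?thesis using assms(2,5) by (simp add: antisym)
qed

section \<open>Couplings of an optimal measure lie close to graphs\<close>

context barycenter_problem
begin

abbreviation map_error :: "((real^'n) \<times> (real^'n)) measure \<Rightarrow> (real^'n \<Rightarrow> real^'n) \<Rightarrow> ennreal" where
  "map_error \<gamma> S \<equiv> (\<integral>\<^sup>+z. ennreal ((norm (fst z - S (snd z)))\<^sup>2) \<partial>\<gamma>)"

text \<open>The given coupling is completed by near-optimal ones for the other indices and glued
  with them. The spread of the result is at least the optimal value \<open>b\<close>, so the bound
  \<open>b + t * C\<close> leaves at most \<open>t * C\<close> for \<open>1 / N\<close> times the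
  map error. The resulting \<epsilon> works for all \<open>j\<close> and \<gamma> at once.\<close>

lemma near_optimal_concentrated:
  assumes opt: "BC_optimal m \<mu> \<nu>" and "0 < \<eta>"
  obtains \<epsilon> where "0 < \<epsilon>"
    "\<And>j \<gamma>. coupling j \<nu> \<gamma> \<Longrightarrow> transport_cost \<gamma> \<le> MK2 m (\<mu> j) \<nu> + ennreal \<epsilon> \<Longrightarrow>
       \<exists>S\<in>borel_measurable borel. map_error \<gamma> S \<le> ennreal \<eta>"
proof -
  let ?N = "real CARD('N)"
  have \<nu>: "\<nu> \<in> measures_of_mass m" using opt by (simp add: BC_optimal_iff)
  obtain b where b: "BC_cost \<nu> = ennreal b" "0 \<le> b"
    using BC_cost_finite[OF \<nu>] by (cases "BC_cost \<nu>") auto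
  define C where "C = b + 2 + 2 * ?N * m"
  have C: "0 < C" using b m_pos by (simp add: C_def add_pos_nonneg)
  \<comment> \<open>Small enough for \<open>?N * (t * C)\<close>, the final bound on the map error,
    to stay below \<eta>.\<close>
  define t where "t = min 1 (\<eta> / (?N * C))"
  have t: "0 < t" "t \<le> 1" using C \<open>0 < \<eta>\<close> by (simp_all add: t_def)
  have tC: "?N * (t * C) \<le> \<eta>" using C by (simp add: t_def min_def field_simps)
  show thesis
  proof (rule that)
    show "0 < t / ?N" using t by simp
    fix j \<gamma> assume \<gamma>: "coupling j \<nu> \<gamma>" and cost: "transport_cost \<gamma> \<le> MK2 m (\<mu> j) \<nu> + ennreal (t / ?N)"
    have "\<exists>\<gamma>. coupling k \<nu> \<gamma> \<and> transport_cost \<gamma> \<le> MK2 m (\<mu> k) \<nu> + ennreal (t / ?N)" for k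
      using t by (intro exists_near_optimal \<nu>) simp
    then obtain G where G: "\<And>k. coupling k \<nu> (G k)"
      and costG: "\<And>k. transport_cost (G k) \<le> MK2 m (\<mu> k) \<nu> + ennreal (t / ?N)" by metis
    define \<Gamma> where "\<Gamma> = G(j := \<gamma>)"
    have \<Gamma>: "coupling k \<nu> (\<Gamma> k)" for k using G[of k] \<gamma> by (auto simp: \<Gamma>_def)
    have "(\<Sum>k\<in>UNIV. transport_cost (\<Gamma> k)) \<le> (\<Sum>k\<in>UNIV. MK2 m (\<mu> k) \<nu> + ennreal (t / ?N))"
      using cost costG by (intro sum_mono) (auto simp: \<Gamma>_def)
    also have "\<dots> = ennreal (b + t)"
      using b t by (simp add: sum.distrib ennreal_of_nat_eq_real_of_nat flip: ennreal_mult)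
    finally have total: "(\<Sum>k\<in>UNIV. transport_cost (\<Gamma> k)) \<le> ennreal (b + t)" .
    obtain \<sigma> where \<sigma>: "multi_coupling \<sigma>" and "\<exists>S\<in>borel_measurable borel. spread_cost \<sigma>
        + ennreal (1 / ?N) * map_error (\<Gamma> j) S \<le> ennreal (b + t * C)"
      unfolding C_def by (rule glue_near_optimal[OF \<nu> \<Gamma> total b(2) t]) blast
    then obtain S where S: "S \<in> borel_measurable borel"
      and le: "spread_cost \<sigma> + ennreal (1 / ?N) * map_error \<gamma> S \<le> ennreal (b + t * C)"
      by (auto simp: \<Gamma>_def)
    \<comment> \<open>The optimality of \<nu> enters here: the average of \<sigma> competes with
      \<nu> and costs at most the spread of \<sigma>.\<close>
    have "ennreal b \<le> spread_cost \<sigma>"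
      using opt multi_coupling_average(1,4)[OF \<sigma>] unfolding BC_optimal_iff b(1)
      by (blast intro: order_trans)
    then have "ennreal b + ennreal (1 / ?N) * map_error \<gamma> S \<le> ennreal b + ennreal (t * C)"
      using le b t C by (auto intro: order_trans add_right_mono simp flip: ennreal_plus)
    then have "ennreal (1 / ?N) * map_error \<gamma> S \<le> ennreal (t * C)"
      by (simp add: ennreal_add_left_cancel_le)
    then have "ennreal ?N * (ennreal (1 / ?N) * map_error \<gamma> S) \<le> ennreal ?N * ennreal (t * C)"
      by (rule mult_left_mono) simp
    also have "\<dots> \<le> ennreal \<eta>" using tC t C by (simp add: ennreal_leI flip: ennreal_mult)
    also have "ennreal ?N * (ennreal (1 / ?N) * map_error \<gamma> S) = map_error \<gamma> S"
      by (simp add: mult.assoc[symmetric] flip: ennreal_mult)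
    finally show "\<exists>S\<in>borel_measurable borel. map_error \<gamma> S \<le> ennreal \<eta>" using S by blast
  qed
qed

text \<open>A midpoint of two near-optimal couplings is near-optimal, so a single map serves both.\<close>

lemma near_optimal_pair_concentrated:
  assumes opt: "BC_optimal m \<mu> \<nu>" and "0 < \<eta>"
  obtains \<epsilon> where "0 < \<epsilon>"
    "\<And>j \<gamma> \<gamma>'. coupling j \<nu> \<gamma> \<Longrightarrow> transport_cost \<gamma> \<le> MK2 m (\<mu> j) \<nu> + ennreal \<epsilon> \<Longrightarrow>
       coupling j \<nu> \<gamma>' \<Longrightarrow> transport_cost \<gamma>' \<le> MK2 m (\<mu> j) \<nu> + ennreal \<epsilon> \<Longrightarrow>
       \<exists>S\<in>borel_measurable borel. map_error \<gamma> S + map_error \<gamma>' S \<le> ennreal \<eta>"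
proof -
  have \<nu>: "sets \<nu> = sets borel" using opt measures_of_massD by (auto simp: BC_optimal_iff)
  have "0 < \<eta> / 2" using \<open>0 < \<eta>\<close> by simp
  then obtain \<epsilon> where "0 < \<epsilon>" and conc:
    "\<And>j \<gamma>. coupling j \<nu> \<gamma> \<Longrightarrow> transport_cost \<gamma> \<le> MK2 m (\<mu> j) \<nu> + ennreal \<epsilon> \<Longrightarrow>
       \<exists>S\<in>borel_measurable borel. map_error \<gamma> S \<le> ennreal (\<eta> / 2)"
    using near_optimal_concentrated[OF opt] by blast
  show thesis
  proof (rule that[OF \<open>0 < \<epsilon>\<close>])
    fix j \<gamma> \<gamma>'
    assume \<gamma>: "coupling j \<nu> \<gamma>" "transport_cost \<gamma> \<le> MK2 m (\<mu> j) \<nu> + ennreal \<epsilon>"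
      and \<gamma>': "coupling j \<nu> \<gamma>'" "transport_cost \<gamma>' \<le> MK2 m (\<mu> j) \<nu> + ennreal \<epsilon>"
    obtain \<kappa> where \<kappa>: "coupling j \<nu> \<kappa>" and int:
      "\<And>f. f \<in> borel_measurable borel \<Longrightarrow> 2 * (\<integral>\<^sup>+x. f x \<partial>\<kappa>) = (\<integral>\<^sup>+x. f x \<partial>\<gamma>) + (\<integral>\<^sup>+x. f x \<partial>\<gamma>')"
      using midpoint_partial_coupling[of \<gamma> "\<mu> j" \<nu> \<gamma>' m] \<gamma>(1) \<gamma>'(1) m_pos sets_\<mu> \<nu> by metis
    have int_err: "2 * map_error \<kappa> S = map_error \<gamma> S + map_error \<gamma>' S" if "S \<in> borel_measurable borel" for S
      by (rule int) (rule borel_measurable_sq_dist_map[OF that refl])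
    \<comment> \<open>The transport cost is the map error of the identity map.\<close>
    have "2 * transport_cost \<kappa> = transport_cost \<gamma> + transport_cost \<gamma>'"
      unfolding transport_cost_eq using int_err[of "\<lambda>y. y"] by simp
    also have "\<dots> \<le> 2 * (MK2 m (\<mu> j) \<nu> + ennreal \<epsilon>)"
      unfolding mult_2 by (intro add_mono \<gamma> \<gamma>')
    finally have "transport_cost \<kappa> \<le> MK2 m (\<mu> j) \<nu> + ennreal \<epsilon>"
      by (rule iffD1[OF ennreal_mult_le_mult_iff, rotated 2]) simp_all
    then obtain S where S: "S \<in> borel_measurable borel" "map_error \<kappa> S \<le> ennreal (\<eta> / 2)"
      using conc[OF \<kappa>] by blast
    have "map_error \<gamma> S + map_error \<gamma>' S \<le> 2 * ennreal (\<eta> / 2)"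
      unfolding int_err[OF S(1), symmetric] by (intro mult_left_mono S) simp
    also have "2 * ennreal (\<eta> / 2) = ennreal \<eta>" using \<open>0 < \<eta>\<close> by (simp only: two_mult_ennreal_half less_imp_le)
    finally show "\<exists>S\<in>borel_measurable borel. map_error \<gamma> S + map_error \<gamma>' S \<le> ennreal \<eta>"
      using S(1) by blast
  qed
qed

lemma Opt_iff: "\<gamma> \<in> Opt m (\<mu> j) \<nu> \<longleftrightarrow> coupling j \<nu> \<gamma> \<and> transport_cost \<gamma> \<le> MK2 m (\<mu> j) \<nu>"
  by (auto simp: Opt_def is_arg_min_linorder MK2_def le_INF_iff)

lemma nn_integral_coupling_snd:
  assumes "\<nu> \<in> measures_of_mass m" "coupling j \<nu> \<gamma>" "f \<in> borel_measurable borel"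
  shows "(\<integral>\<^sup>+y. f y \<partial>\<nu>) = (\<integral>\<^sup>+z. f (snd z) \<partial>\<gamma>)"
proof -
  have "snd \<in> borel_measurable \<gamma>" using sets_coupling[OF assms(2)] by (simp cong: measurable_cong_sets)
  then show ?thesis unfolding coupling_snd[OF assms(1,2), symmetric] by (rule nn_integral_distr) (use assms(3) in simp)
qed

text \<open>\<gamma> and the graph coupling of \<open>S\<close> are both optimal, so some map
  \<open>T\<close> fits both within any prescribed error. Then \<open>T\<close> is close to
  \<open>S\<close>, and \<gamma> is close to the graph of \<open>S\<close>; since the error is
  arbitrary, it is zero.\<close>

lemma Opt_concentrated_on_optimal_map:
  assumes opt: "BC_optimal m \<mu> \<nu>" and \<gamma>: "\<gamma> \<in> Opt m (\<mu> j) \<nu>" and S: "optimal_map m (\<mu> j) \<nu> S"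
  shows "AE z in \<gamma>. fst z = S (snd z)"
proof -
  have \<nu>: "\<nu> \<in> measures_of_mass m" using opt by (simp add: BC_optimal_iff)
  have coup: "coupling j \<nu> \<gamma>" using \<gamma> by (simp add: Opt_iff)
  define \<gamma>' where "\<gamma>' = distr \<nu> borel (\<lambda>y. (S y, y))"
  have Sm[measurable]: "S \<in> borel_measurable borel" and \<gamma>': "\<gamma>' \<in> Opt m (\<mu> j) \<nu>"
    using S by (auto simp: optimal_map_def \<gamma>'_def)
  have s\<nu>: "sets \<nu> = sets borel" using measures_of_massD[OF \<nu>] by simp
  have pair: "(\<lambda>y. (S y, y)) \<in> \<nu> \<rightarrow>\<^sub>M borel"
    unfolding measurable_cong_sets[OF s\<nu> refl] borel_prod[symmetric] by measurable
  have "map_error \<gamma> S \<le> ennreal \<eta>" if "0 < \<eta>" for \<eta>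
  proof -
    have "0 < \<eta> / 2" using that by simp
    then obtain \<epsilon> where "0 < \<epsilon>" and conc:
      "\<And>j \<gamma> \<gamma>'. coupling j \<nu> \<gamma> \<Longrightarrow> transport_cost \<gamma> \<le> MK2 m (\<mu> j) \<nu> + ennreal \<epsilon> \<Longrightarrow>
       coupling j \<nu> \<gamma>' \<Longrightarrow> transport_cost \<gamma>' \<le> MK2 m (\<mu> j) \<nu> + ennreal \<epsilon> \<Longrightarrow>
       \<exists>S\<in>borel_measurable borel. map_error \<gamma> S + map_error \<gamma>' S \<le> ennreal (\<eta> / 2)"
      using near_optimal_pair_concentrated[OF opt \<open>0 < \<eta> / 2\<close>] by blast
    obtain T where T[measurable]: "T \<in> borel_measurable borel"
      and le: "map_error \<gamma> T + map_error \<gamma>' T \<le> ennreal (\<eta> / 2)"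
      using conc[where j = j and \<gamma> = \<gamma> and \<gamma>' = \<gamma>'] \<gamma> \<gamma>' unfolding Opt_iff by (meson le_iff_add order_trans)
    \<comment> \<open>On the graph coupling the error of \<open>T\<close> is its squared distance to
      \<open>S\<close> under \<nu>, which can be read under \<gamma> because the second marginal of
      \<gamma> is \<nu>.\<close>
    have "map_error \<gamma>' T = (\<integral>\<^sup>+y. ennreal ((norm (S y - T y))\<^sup>2) \<partial>\<nu>)"
      unfolding \<gamma>'_def
      by (subst nn_integral_distr[OF pair]) (auto intro: borel_measurable_sq_dist_map[OF T])
    also have "\<dots> = (\<integral>\<^sup>+z. ennreal ((norm (S (snd z) - T (snd z)))\<^sup>2) \<partial>\<gamma>)"
      by (rule nn_integral_coupling_snd[OF \<nu> coup]) measurable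
    finally have err': "map_error \<gamma>' T = (\<integral>\<^sup>+z. ennreal ((norm (S (snd z) - T (snd z)))\<^sup>2) \<partial>\<gamma>)" .
    have s\<gamma>: "sets \<gamma> = sets borel" using sets_coupling[OF coup] .
    have m1: "(\<lambda>z. ennreal ((norm (fst z - T (snd z)))\<^sup>2)) \<in> borel_measurable \<gamma>"
      by (rule borel_measurable_sq_dist_map[OF T s\<gamma>])
    have m2: "(\<lambda>z. ennreal ((norm (S (snd z) - T (snd z)))\<^sup>2)) \<in> borel_measurable \<gamma>"
      unfolding measurable_cong_sets[OF s\<gamma> refl]
      by (rule measurable_compose[where f = snd and g = "\<lambda>y. ennreal ((norm (S y - T y))\<^sup>2)"]) measurable
    have "map_error \<gamma> S \<le> (\<integral>\<^sup>+z. 2 * ennreal ((norm (fst z - T (snd z)))\<^sup>2) + 2 * ennreal ((norm (S (snd z) - T (snd z)))\<^sup>2) \<partial>\<gamma>)"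
      by (intro nn_integral_mono ennreal_norm_diff_sq_le)
    also have "\<dots> = 2 * (map_error \<gamma> T + map_error \<gamma>' T)"
      unfolding err' using m1 m2 by (simp add: nn_integral_add nn_integral_cmult distrib_left)
    also have "\<dots> \<le> 2 * ennreal (\<eta> / 2)" by (intro mult_left_mono le) simp
    also have "\<dots> = ennreal \<eta>" using that by (simp only: two_mult_ennreal_half less_imp_le)
    finally show ?thesis .
  qed
  then have small: "map_error \<gamma> S \<le> 0 + ennreal \<eta>" if "0 < \<eta>" for \<eta>
    using that by simp
  have "map_error \<gamma> S \<le> 0"
    by (rule ennreal_le_epsilon) (rule small)
  then have "AE z in \<gamma>. ennreal ((norm (fst z - S (snd z)))\<^sup>2) = 0"
    using borel_measurable_sq_dist_map[OF Sm sets_coupling[OF coup]] by (simp add: nn_integral_0_iff_AE)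
  then show ?thesis by (rule AE_mp) simp
qed

end

section \<open>Existence of optimal maps\<close>

text \<open>The terms of a finite sum are bounded, so the weight \<open>4 ^ k\<close> on the squares
  makes the steps decay like \<open>(1 / 2) ^ k\<close>.\<close>

lemma convergent_of_geometric_steps:
  fixes s :: "nat \<Rightarrow> 'a::banach"
  assumes "(\<Sum>k. ennreal (4 ^ k * (norm (s k - s (Suc k)))\<^sup>2)) \<noteq> \<infinity>"
  shows "convergent s"
proof -
  have "(\<Sum>k. ennreal (4 ^ k * (norm (s k - s (Suc k)))\<^sup>2)) < top"
    using assms by (simp add: less_top)
  then have sm: "summable (\<lambda>k. 4 ^ k * (norm (s k - s (Suc k)))\<^sup>2)"
    by (intro summable_suminf_not_top) (auto simp: less_top)
  then obtain c where c: "\<And>k. 4 ^ k * (norm (s k - s (Suc k)))\<^sup>2 \<le> c"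
    using summable_imp_Bseq[OF sm] by (auto simp: Bseq_def)
  then have c0: "0 \<le> c" using order_trans[OF _ c[of 0]] by simp
  have bound: "norm (s k - s (Suc k)) \<le> sqrt c * (1 / 2) ^ k" for k
  proof (rule power2_le_imp_le)
    have "(2::real) ^ k * 2 ^ k = 4 ^ k" by (simp flip: power_mult_distrib)
    then show "(norm (s k - s (Suc k)))\<^sup>2 \<le> (sqrt c * (1 / 2) ^ k)\<^sup>2"
      using c[of k] c0 by (simp add: power_mult_distrib power_divide field_simps power2_eq_square)
  qed (use c0 in simp)
  have "summable (\<lambda>k. sqrt c * (1 / 2) ^ k)"
    by (intro summable_mult summable_geometric) simp
  then have "summable (\<lambda>k. s k - s (Suc k))"
    by (rule summable_comparison_test'[where N = 0]) (rule bound)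
  then have "convergent (\<lambda>n. \<Sum>k<n. s k - s (Suc k))" by (simp add: summable_iff_convergent)
  then have conv: "convergent (\<lambda>n. s 0 - (\<Sum>k<n. s k - s (Suc k)))"
    using convergent_diff[OF convergent_const[of "s 0"]] by blast
  have "(\<lambda>n. s 0 - (\<Sum>k<n. s k - s (Suc k))) = s"
    by (rule ext) (simp only: sum_lessThan_telescope' diff_diff_eq2 add_diff_cancel_left' diff_add_cancel)
  with conv show ?thesis by (simp only:)
qed

text \<open>Fatou's lemma in the form needed for both limits in \<open>exists_optimal_map\<close>,
  that of the first marginal and that of the cost.\<close>

lemma nn_integral_le_of_liminf:
  assumes "X \<longlonglongrightarrow> (L::ennreal)" "(\<integral>\<^sup>+x. f x \<partial>M) \<le> (\<integral>\<^sup>+x. liminf (\<lambda>k. u k x) \<partial>M)"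
    and "\<And>k. u k \<in> borel_measurable M" "\<And>k. (\<integral>\<^sup>+x. u k x \<partial>M) \<le> X k"
  shows "(\<integral>\<^sup>+x. f x \<partial>M) \<le> L"
proof -
  note assms(2)
  also have "(\<integral>\<^sup>+x. liminf (\<lambda>k. u k x) \<partial>M) \<le> liminf (\<lambda>k. \<integral>\<^sup>+x. u k x \<partial>M)"
    by (rule nn_integral_liminf) (rule assms(3))
  also have "\<dots> \<le> liminf X" by (rule Liminf_mono) (simp add: assms(4))
  also have "\<dots> = L" by (rule lim_imp_Liminf[OF _ assms(1)]) simp
  finally show ?thesis .
qed

context barycenter_problem
begin

text \<open>The maps obtained from the concentration property form a Cauchy sequence in
  \<open>L\<^sup>2(\<nu>)\<close>; completeness replaces a weak compactness argument for couplings.\<close>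

lemma approximating_maps:
  assumes opt: "BC_optimal m \<mu> \<nu>"
  obtains \<gamma> :: "nat \<Rightarrow> ((real^'n) \<times> (real^'n)) measure" and T :: "nat \<Rightarrow> real^'n \<Rightarrow> real^'n" and S
  where "\<And>k. coupling j \<nu> (\<gamma> k)"
    "\<And>k. transport_cost (\<gamma> k) \<le> MK2 m (\<mu> j) \<nu> + ennreal ((1/2)^k)"
    "\<And>k. T k \<in> borel_measurable borel" "\<And>k. map_error (\<gamma> k) (T k) \<le> ennreal ((1/16)^k)"
    "S \<in> borel_measurable borel" "AE y in \<nu>. (\<lambda>k. T k y) \<longlonglongrightarrow> S y"
proof -
  have \<nu>: "\<nu> \<in> measures_of_mass m" using opt by (simp add: BC_optimal_iff)
  have s\<nu>: "sets \<nu> = sets borel" using measures_of_massD[OF \<nu>] by simp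
  define good where "good k \<epsilon> \<longleftrightarrow> (\<forall>j \<gamma> \<gamma>'. coupling j \<nu> \<gamma> \<longrightarrow> transport_cost \<gamma> \<le> MK2 m (\<mu> j) \<nu> + ennreal \<epsilon> \<longrightarrow>
       coupling j \<nu> \<gamma>' \<longrightarrow> transport_cost \<gamma>' \<le> MK2 m (\<mu> j) \<nu> + ennreal \<epsilon> \<longrightarrow>
       (\<exists>S\<in>borel_measurable borel. map_error \<gamma> S + map_error \<gamma>' S \<le> ennreal ((1/16)^k)))" for k \<epsilon>
  have "\<exists>\<epsilon>>0. good k \<epsilon>" for k
  proof -
    have "(0::real) < (1/16)^k" by simp
    then show ?thesis
    proof (rule near_optimal_pair_concentrated[OF opt])
      fix \<epsilon> :: real
      assume "0 < \<epsilon>" and near: "coupling j \<nu> \<gamma> \<Longrightarrow>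
        transport_cost \<gamma> \<le> MK2 m (\<mu> j) \<nu> + ennreal \<epsilon> \<Longrightarrow>
        coupling j \<nu> \<gamma>' \<Longrightarrow> transport_cost \<gamma>' \<le> MK2 m (\<mu> j) \<nu> + ennreal \<epsilon> \<Longrightarrow>
        \<exists>S\<in>borel_measurable borel. map_error \<gamma> S + map_error \<gamma>' S \<le> ennreal ((1/16)^k)" for j \<gamma> \<gamma>'
      have "good k \<epsilon>" unfolding good_def by (intro allI impI) (rule near; assumption)
      with \<open>0 < \<epsilon>\<close> show "\<exists>\<epsilon>>0. good k \<epsilon>" by blast
    qed
  qed
  then obtain e where e: "\<And>k. 0 < e k" and good: "\<And>k. good k (e k)" by metis
  have conc: "\<exists>S\<in>borel_measurable borel. map_error \<gamma> S + map_error \<gamma>' S \<le> ennreal ((1/16)^k)"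
    if "coupling j \<nu> \<gamma>" "transport_cost \<gamma> \<le> MK2 m (\<mu> j) \<nu> + ennreal (e k)"
      "coupling j \<nu> \<gamma>'" "transport_cost \<gamma>' \<le> MK2 m (\<mu> j) \<nu> + ennreal (e k)" for k j \<gamma> \<gamma>'
    by (rule good[unfolded good_def, rule_format, OF that])
  \<comment> \<open>The minimum over all earlier thresholds makes the couplings numbered
    \<open>k\<close> and \<open>Suc k\<close> both good enough for the threshold \<open>e k\<close>,
    so that one map fits the two.\<close>
  define d where "d k = min ((1/2)^k) (Min (e ` {..k}))" for k
  have d: "0 < d k" "d k \<le> (1/2)^k" "d k \<le> e k" "d (Suc k) \<le> e k" for k
    using e by (auto simp: d_def Min_gr_iff min_le_iff_disj)
  have "\<exists>\<gamma>. coupling j \<nu> \<gamma> \<and> transport_cost \<gamma> \<le> MK2 m (\<mu> j) \<nu> + ennreal (d k)" for k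
    by (rule exists_near_optimal[OF \<nu> d(1)])
  then obtain \<gamma> where \<gamma>: "\<And>k. coupling j \<nu> (\<gamma> k)"
    and cost: "\<And>k. transport_cost (\<gamma> k) \<le> MK2 m (\<mu> j) \<nu> + ennreal (d k)" by metis
  have cost_le: "transport_cost (\<gamma> k) \<le> MK2 m (\<mu> j) \<nu> + ennreal r" if "d k \<le> r" for k r
    using order_trans[OF cost[of k] add_left_mono[OF ennreal_leI[OF that]]] .
  define fits where "fits k S \<longleftrightarrow> S \<in> borel_measurable borel \<and>
    map_error (\<gamma> k) S + map_error (\<gamma> (Suc k)) S \<le> ennreal ((1/16)^k)" for k S
  have "\<exists>S. fits k S" for k
    using conc[OF \<gamma> cost_le[OF d(3)] \<gamma> cost_le[OF d(4)], of k] by (auto simp: fits_def)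
  then obtain T where "\<And>k. fits k (T k)" by metis
  then have T[measurable]: "T k \<in> borel_measurable borel"
    and err: "map_error (\<gamma> k) (T k) + map_error (\<gamma> (Suc k)) (T k) \<le> ennreal ((1/16)^k)" for k
    by (simp_all add: fits_def)
  have err1: "map_error (\<gamma> k) (T k) \<le> ennreal ((1/16)^k)"
    and err2: "map_error (\<gamma> (Suc k)) (T k) \<le> ennreal ((1/16)^k)" for k
    by (rule order_trans[OF _ err[of k]], simp)+
  \<comment> \<open>Successive maps both fit the coupling numbered \<open>Suc k\<close>, through
    which they are compared.\<close>
  have step: "(\<integral>\<^sup>+y. ennreal ((norm (T k y - T (Suc k) y))\<^sup>2) \<partial>\<nu>) \<le> ennreal (4 * (1/16)^k)" for k
  proof -
    note sg = sets_coupling[OF \<gamma>[of "Suc k"]]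
    note m1 = borel_measurable_sq_dist_map[OF T[of k] sg]
    note m2 = borel_measurable_sq_dist_map[OF T[of "Suc k"] sg]
    have "(\<integral>\<^sup>+y. ennreal ((norm (T k y - T (Suc k) y))\<^sup>2) \<partial>\<nu>)
        = (\<integral>\<^sup>+z. ennreal ((norm (T k (snd z) - T (Suc k) (snd z)))\<^sup>2) \<partial>\<gamma> (Suc k))"
      by (rule nn_integral_coupling_snd[OF \<nu> \<gamma>]) measurable
    also have "\<dots> \<le> (\<integral>\<^sup>+z. 2 * ennreal ((norm (fst z - T k (snd z)))\<^sup>2)
        + 2 * ennreal ((norm (fst z - T (Suc k) (snd z)))\<^sup>2) \<partial>\<gamma> (Suc k))"
    proof (rule nn_integral_mono)
      show "ennreal ((norm (T k (snd z) - T (Suc k) (snd z)))\<^sup>2) \<le> 2 * ennreal ((norm (fst z - T k (snd z)))\<^sup>2)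
        + 2 * ennreal ((norm (fst z - T (Suc k) (snd z)))\<^sup>2)" for z
        using ennreal_norm_diff_sq_le[of "T k (snd z)" "T (Suc k) (snd z)" "fst z"]
        by (simp only: norm_minus_commute[of "fst z"])
    qed
    also have "\<dots> = 2 * map_error (\<gamma> (Suc k)) (T k) + 2 * map_error (\<gamma> (Suc k)) (T (Suc k))"
      using m1 m2 by (simp add: nn_integral_add nn_integral_cmult)
    also have "\<dots> \<le> 2 * ennreal ((1/16)^k) + 2 * ennreal ((1/16)^k)"
    proof (intro add_mono mult_left_mono err2 order_trans[OF err1])
      show "ennreal ((1/16) ^ Suc k) \<le> ennreal ((1/16)^k)" by (intro ennreal_leI power_decreasing) auto
    qed auto
    also have "\<dots> = ennreal (4 * (1/16)^k)"
      by (simp add: ennreal_mult flip: distrib_right)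
    finally show ?thesis .
  qed
  have "(\<integral>\<^sup>+y. (\<Sum>k. ennreal (4 ^ k * (norm (T k y - T (Suc k) y))\<^sup>2)) \<partial>\<nu>)
      = (\<Sum>k. ennreal (4 ^ k) * (\<integral>\<^sup>+y. ennreal ((norm (T k y - T (Suc k) y))\<^sup>2) \<partial>\<nu>))"
  proof -
    have "(\<lambda>y. ennreal ((norm (T k y - T (Suc k) y))\<^sup>2)) \<in> borel_measurable \<nu>" for k
      unfolding measurable_cong_sets[OF s\<nu> refl] by measurable
    then show ?thesis by (simp add: ennreal_mult nn_integral_suminf nn_integral_cmult)
  qed
  \<comment> \<open>The error rate \<open>(1/16)^k\<close> leaves a summable \<open>(1/4)^k\<close>
    after multiplication by the weight \<open>4 ^ k\<close>; the same rate absorbs the Chebyshev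
    factor in \<open>exists_optimal_map\<close>.\<close>
  also have "\<dots> \<le> (\<Sum>k. ennreal (4 * (1/4)^k))"
  proof (intro suminf_le)
    fix k
    have "ennreal (4 ^ k) * (\<integral>\<^sup>+y. ennreal ((norm (T k y - T (Suc k) y))\<^sup>2) \<partial>\<nu>)
        \<le> ennreal (4 ^ k) * ennreal (4 * (1/16)^k)"
      by (intro mult_left_mono step) simp
    also have "\<dots> = ennreal (4 ^ k * (4 * (1/16)^k))" by (rule ennreal_mult[symmetric]) simp_all
    also have "4 ^ k * (4 * (1/16)^k) = 4 * (1/4)^k * (1::real)"
    proof -
      have "(4::real) ^ k * (1/16)^k = (1/4)^k" by (simp flip: power_mult_distrib)
      then show ?thesis by simp
    qed
    finally show "ennreal (4 ^ k) * (\<integral>\<^sup>+y. ennreal ((norm (T k y - T (Suc k) y))\<^sup>2) \<partial>\<nu>) \<le> ennreal (4 * (1/4)^k)"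
      by simp
  qed auto
  also have "\<dots> < \<infinity>"
    by (subst suminf_ennreal2) (auto intro!: summable_mult summable_geometric)
  finally have "(\<integral>\<^sup>+y. (\<Sum>k. ennreal (4 ^ k * (norm (T k y - T (Suc k) y))\<^sup>2)) \<partial>\<nu>) \<noteq> \<infinity>" by simp
  moreover have "(\<lambda>y. \<Sum>k. ennreal (4 ^ k * (norm (T k y - T (Suc k) y))\<^sup>2)) \<in> borel_measurable \<nu>"
    unfolding measurable_cong_sets[OF s\<nu> refl] by measurable
  ultimately have "AE y in \<nu>. (\<Sum>k. ennreal (4 ^ k * (norm (T k y - T (Suc k) y))\<^sup>2)) \<noteq> \<infinity>"
    by (intro nn_integral_PInf_AE) auto
  then have "AE y in \<nu>. (\<lambda>k. T k y) \<longlonglongrightarrow> lim (\<lambda>k. T k y)"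
    by (rule AE_mp) (auto intro!: AE_I2 convergent_of_geometric_steps simp flip: convergent_LIMSEQ_iff)
  moreover have "(\<lambda>y. lim (\<lambda>k. T k y)) \<in> borel_measurable borel" by measurable
  ultimately show thesis using that[OF \<gamma> cost_le[OF d(2)] T err1] by blast
qed

text \<open>The graph of the limit map is shown to be admissible and of cost at most
  \<open>MK2\<close>. Both facts hold for the approximating maps up to vanishing errors and pass to
  the limit by Fatou's lemma.\<close>

lemma exists_optimal_map:
  assumes opt: "BC_optimal m \<mu> \<nu>"
  shows "\<exists>S. optimal_map m (\<mu> j) \<nu> S"
proof -
  have \<nu>: "\<nu> \<in> measures_of_mass m" using opt by (simp add: BC_optimal_iff)
  have s\<nu>: "sets \<nu> = sets borel" and mass\<nu>: "mass \<nu> = ennreal m" using measures_of_massD[OF \<nu>] by auto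
  have sp: "space \<nu> = UNIV" using sets_eq_imp_space_eq[OF s\<nu>] by simp
  note m\<nu> = measurable_cong_sets[OF s\<nu> refl]
  obtain \<gamma> T S where \<gamma>: "\<And>k. coupling j \<nu> (\<gamma> k)"
    and cost: "\<And>k. transport_cost (\<gamma> k) \<le> MK2 m (\<mu> j) \<nu> + ennreal ((1/2)^k)"
    and T[measurable]: "\<And>k. T k \<in> borel_measurable borel"
    and err: "\<And>k. map_error (\<gamma> k) (T k) \<le> ennreal ((1/16)^k)"
    and S[measurable]: "S \<in> borel_measurable borel"
    and lim: "AE y in \<nu>. (\<lambda>k. T k y) \<longlonglongrightarrow> S y"
    by (rule approximating_maps[OF opt, of j]) blast
  note s\<gamma> = sets_coupling[OF \<gamma>]
  have Sm: "S \<in> borel_measurable \<nu>" unfolding m\<nu> by (rule S)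
  have m_err: "(\<lambda>z. ennreal ((norm (fst z - T k (snd z)))\<^sup>2)) \<in> borel_measurable (\<gamma> k)" for k
    by (rule borel_measurable_sq_dist_map[OF T s\<gamma>])
  obtain b where b: "MK2 m (\<mu> j) \<nu> = ennreal b" "0 \<le> b"
    using MK2_finite[OF \<nu>, of j] by (cases "MK2 m (\<mu> j) \<nu>") auto
  have "distr \<nu> borel S \<le> \<mu> j"
  proof (rule le_measure_of_open)
    show "sets (distr \<nu> borel S) = sets borel" "sets (\<mu> j) = sets borel" by (simp_all add: sets_\<mu>)
    show "emeasure (\<mu> j) (space (\<mu> j)) \<noteq> \<infinity>" using finite_mass_\<mu>[of j] by (simp add: mass_def)
    fix U :: "(real^'n) set" assume U: "open U"
    \<comment> \<open>The points at distance at least \<open>(1/2)^k\<close> from the complement of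
      \<open>U\<close>: these sets increase to \<open>U\<close>, and a point outside
      \<open>U\<close> is never closer than \<open>(1/2)^k\<close> to \<open>V k\<close>.\<close>
    define V where "V k = - (\<Union>z\<in>- U. ball z ((1/2)^k))" for k :: nat
    have V: "V k \<in> sets borel" for k
    proof -
      have "open (\<Union>z\<in>- U. ball z ((1/2)^k))" by blast
      then show ?thesis unfolding V_def by (intro borel_closed) (simp only: closed_Compl)
    qed
    have "(\<integral>\<^sup>+y. indicator U (S y) \<partial>\<nu>) \<le> emeasure (\<mu> j) U"
    proof (rule nn_integral_le_of_liminf[where u = "\<lambda>k y. indicator (V k) (T k y)" and X = "\<lambda>k. emeasure (\<mu> j) U + ennreal ((1/4)^k)"])
      have "(\<lambda>k. emeasure (\<mu> j) U + ennreal ((1/4)^k)) \<longlonglongrightarrow> emeasure (\<mu> j) U + ennreal 0"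
        by (intro tendsto_add tendsto_const tendsto_ennrealI LIMSEQ_power_zero) simp
      then show "(\<lambda>k. emeasure (\<mu> j) U + ennreal ((1/4)^k)) \<longlonglongrightarrow> emeasure (\<mu> j) U" by simp
      show "(\<lambda>y. indicator (V k) (T k y) :: ennreal) \<in> borel_measurable \<nu>" for k
        unfolding m\<nu> by (rule measurable_compose[OF T borel_measurable_indicator[OF V]])
      show "(\<integral>\<^sup>+y. indicator U (S y) \<partial>\<nu>) \<le> (\<integral>\<^sup>+y. liminf (\<lambda>k. indicator (V k) (T k y)) \<partial>\<nu>)"
      proof (rule nn_integral_mono_AE, rule AE_mp[OF lim], intro AE_I2 impI)
        fix y assume lim: "(\<lambda>k. T k y) \<longlonglongrightarrow> S y"
        show "(indicator U (S y) :: ennreal) \<le> liminf (\<lambda>k. indicator (V k) (T k y))"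
        proof (cases "S y \<in> U")
          case True
          then obtain r where r: "0 < r" "ball (S y) r \<subseteq> U" using U openE by blast
          have "eventually (\<lambda>k. dist (T k y) (S y) < r / 2) sequentially"
            using lim r(1) by (intro tendstoD) auto
          moreover have "eventually (\<lambda>k. (1/2)^k < r / 2) sequentially"
            using r(1) by (intro order_tendstoD(2)[OF LIMSEQ_power_zero]) auto
          ultimately have "eventually (\<lambda>k. T k y \<in> V k) sequentially"
          proof eventually_elim
            case (elim k)
            have "z \<in> U" if "dist z (T k y) < (1/2)^k" for z
            proof -
              have "dist (S y) z < r"
                using dist_triangle[of "S y" z "T k y"] that elim by (simp add: dist_commute)
              then show ?thesis using r(2) by auto
            qed
            then show ?case by (auto simp: V_def)
          qed
          then show ?thesis
            by (intro Liminf_bounded) (auto elim!: eventually_mono simp: True)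
        qed simp
      qed
      show "(\<integral>\<^sup>+y. indicator (V k) (T k y) \<partial>\<nu>) \<le> emeasure (\<mu> j) U + ennreal ((1/4)^k)" for k
      proof -
        have fst: "fst \<in> borel_measurable (\<gamma> k)"
          unfolding measurable_cong_sets[OF s\<gamma> refl] by measurable
        have "(\<integral>\<^sup>+y. indicator (V k) (T k y) \<partial>\<nu>) = (\<integral>\<^sup>+z. indicator (V k) (T k (snd z)) \<partial>\<gamma> k)"
          by (rule nn_integral_coupling_snd[OF \<nu> \<gamma>]) (rule measurable_compose[OF T borel_measurable_indicator[OF V]])
        \<comment> \<open>Chebyshev: if \<open>T k (snd z)\<close> lies in \<open>V k\<close> while
          \<open>fst z\<close> is outside \<open>U\<close>, their squared distance is at least
          \<open>(1/4)^k\<close>. This event thus has mass at most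
          \<open>4^k * (1/16)^k\<close>.\<close>
        also have "\<dots> \<le> (\<integral>\<^sup>+z. indicator U (fst z) + ennreal (4^k) * ennreal ((norm (fst z - T k (snd z)))\<^sup>2) \<partial>\<gamma> k)"
        proof (rule nn_integral_mono)
          fix z
          show "indicator (V k) (T k (snd z)) \<le> indicator U (fst z) + ennreal (4^k) * ennreal ((norm (fst z - T k (snd z)))\<^sup>2)"
          proof (cases "T k (snd z) \<in> V k \<and> fst z \<notin> U")
            case True
            then have "(1/2)^k \<le> norm (fst z - T k (snd z))" by (auto simp: V_def dist_norm not_less)
            then have "((1/2)^k)\<^sup>2 \<le> (norm (fst z - T k (snd z)))\<^sup>2" by (intro power_mono) auto
            then have "4^k * ((1/2)^k)\<^sup>2 \<le> 4^k * (norm (fst z - T k (snd z)))\<^sup>2" by (intro mult_left_mono) auto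
            moreover have "(4::real)^k * ((1/2)^k)\<^sup>2 = 1"
              by (simp add: power2_eq_square flip: power_mult_distrib)
            ultimately have "ennreal 1 \<le> ennreal (4^k * (norm (fst z - T k (snd z)))\<^sup>2)" by (intro ennreal_leI) simp
            then show ?thesis using True by (simp add: ennreal_mult)
          qed (auto simp: indicator_def)
        qed
        also have "\<dots> = (\<integral>\<^sup>+z. indicator U (fst z) \<partial>\<gamma> k) + ennreal (4^k) * map_error (\<gamma> k) (T k)"
        proof -
          have "(\<lambda>z. indicator U (fst z) :: ennreal) \<in> borel_measurable (\<gamma> k)"
            using U by (intro measurable_compose[OF fst]) simp
          then show ?thesis using m_err[of k] by (simp add: nn_integral_add nn_integral_cmult)
        qed
        also have "(\<integral>\<^sup>+z. indicator U (fst z) \<partial>\<gamma> k) = emeasure (distr (\<gamma> k) borel fst) U"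
          using U by (subst nn_integral_distr[OF fst, symmetric]) auto
        also have "\<dots> + ennreal (4^k) * map_error (\<gamma> k) (T k) \<le> emeasure (\<mu> j) U + ennreal (4^k) * ennreal ((1/16)^k)"
          using \<gamma>[of k] by (intro add_mono mult_left_mono err le_measureD3) (auto simp: partial_couplings_def sets_\<mu>)
        also have "ennreal (4^k) * ennreal ((1/16)^k) = ennreal ((1/4)^k)"
          by (simp flip: ennreal_mult power_mult_distrib)
        finally show ?thesis .
      qed
    qed
    also have "(\<integral>\<^sup>+y. indicator U (S y) \<partial>\<nu>) = emeasure (distr \<nu> borel S) U"
      using U by (subst nn_integral_distr[OF Sm, symmetric]) auto
    finally show "emeasure (distr \<nu> borel S) U \<le> emeasure (\<mu> j) U" .
  qed
  moreover have pair: "(\<lambda>y. (S y, y)) \<in> \<nu> \<rightarrow>\<^sub>M borel"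
    unfolding m\<nu> borel_prod[symmetric] by measurable
  moreover have "distr \<nu> borel (\<lambda>y. y) = \<nu>" by (rule distr_id2) (simp add: s\<nu>)
  ultimately have coup: "coupling j \<nu> (distr \<nu> borel (\<lambda>y. (S y, y)))"
    by (auto simp: partial_couplings_def distr_distr comp_def mass_def emeasure_distr mass\<nu>[unfolded mass_def])
  have "(\<integral>\<^sup>+y. ennreal ((norm (S y - y))\<^sup>2) \<partial>\<nu>) \<le> MK2 m (\<mu> j) \<nu>"
  \<comment> \<open>Young's inequality with weight \<open>(1/2)^k\<close>: the cost of the coupling
    numbered \<open>k\<close> gets a factor tending to 1, and the map error gets the factor
    \<open>1 + 2^k\<close>, which the rate \<open>(1/16)^k\<close> turns into
    \<open>(1/16)^k + (1/8)^k\<close>.\<close>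
  proof (rule nn_integral_le_of_liminf[where u = "\<lambda>k y. ennreal ((norm (T k y - y))\<^sup>2)"
        and X = "\<lambda>k. ennreal ((1 + (1/2)^k) * (b + (1/2)^k) + ((1/16)^k + (1/8)^k))"])
    have "(\<lambda>k. (1 + (1/2)^k) * (b + (1/2)^k) + ((1/16)^k + (1/8)^k)) \<longlonglongrightarrow> (1 + 0) * (b + 0) + (0 + 0)"
      by (intro tendsto_intros LIMSEQ_power_zero) auto
    then show "(\<lambda>k. ennreal ((1 + (1/2)^k) * (b + (1/2)^k) + ((1/16)^k + (1/8)^k))) \<longlonglongrightarrow> MK2 m (\<mu> j) \<nu>"
      unfolding b(1) by (intro tendsto_ennrealI) simp
    show "(\<lambda>y. ennreal ((norm (T k y - y))\<^sup>2)) \<in> borel_measurable \<nu>" for k unfolding m\<nu> by measurable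
    show "(\<integral>\<^sup>+y. ennreal ((norm (S y - y))\<^sup>2) \<partial>\<nu>) \<le> (\<integral>\<^sup>+y. liminf (\<lambda>k. ennreal ((norm (T k y - y))\<^sup>2)) \<partial>\<nu>)"
    proof (rule nn_integral_mono_AE, rule AE_mp[OF lim], intro AE_I2 impI)
      fix y assume "(\<lambda>k. T k y) \<longlonglongrightarrow> S y"
      then have conv: "(\<lambda>k. ennreal ((norm (T k y - y))\<^sup>2)) \<longlonglongrightarrow> ennreal ((norm (S y - y))\<^sup>2)"
        by (intro tendsto_ennrealI tendsto_power tendsto_norm tendsto_diff tendsto_const)
      show "ennreal ((norm (S y - y))\<^sup>2) \<le> liminf (\<lambda>k. ennreal ((norm (T k y - y))\<^sup>2))"
        by (subst lim_imp_Liminf[OF sequentially_bot conv]) (rule order_refl)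
    qed
    show "(\<integral>\<^sup>+y. ennreal ((norm (T k y - y))\<^sup>2) \<partial>\<nu>) \<le> ennreal ((1 + (1/2)^k) * (b + (1/2)^k) + ((1/16)^k + (1/8)^k))" for k
    proof -
      let ?t = "(1/2)^k :: real"
      have m_cost: "(\<lambda>z. ennreal ((norm (fst z - snd z))\<^sup>2)) \<in> borel_measurable (\<gamma> k)"
        by (rule borel_measurable_sq_dist_map[where S = "\<lambda>y. y", OF _ s\<gamma>]) simp
      have "(\<integral>\<^sup>+y. ennreal ((norm (T k y - y))\<^sup>2) \<partial>\<nu>) = (\<integral>\<^sup>+z. ennreal ((norm (T k (snd z) - snd z))\<^sup>2) \<partial>\<gamma> k)"
        by (rule nn_integral_coupling_snd[OF \<nu> \<gamma>]) measurable
      also have "\<dots> \<le> (\<integral>\<^sup>+z. ennreal (1 + ?t) * ennreal ((norm (fst z - snd z))\<^sup>2)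
          + ennreal (1 + 1 / ?t) * ennreal ((norm (fst z - T k (snd z)))\<^sup>2) \<partial>\<gamma> k)"
      proof (rule nn_integral_mono)
        fix z :: "(real^'n) \<times> (real^'n)"
        have "(norm (T k (snd z) - snd z))\<^sup>2
            \<le> (1 + ?t) * (norm (fst z - snd z))\<^sup>2 + (1 + 1 / ?t) * (norm (fst z - T k (snd z)))\<^sup>2"
          using norm_add_sq_le[of ?t "fst z - snd z" "T k (snd z) - fst z"] by (simp add: norm_minus_commute)
        then have "ennreal ((norm (T k (snd z) - snd z))\<^sup>2)
            \<le> ennreal ((1 + ?t) * (norm (fst z - snd z))\<^sup>2 + (1 + 1 / ?t) * (norm (fst z - T k (snd z)))\<^sup>2)"
          by (rule ennreal_leI)
        also have "\<dots> = ennreal (1 + ?t) * ennreal ((norm (fst z - snd z))\<^sup>2)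
            + ennreal (1 + 1 / ?t) * ennreal ((norm (fst z - T k (snd z)))\<^sup>2)"
          by (simp only: ennreal_plus ennreal_mult zero_le_power2 zero_le_mult_iff add_nonneg_nonneg
              zero_le_one zero_le_power zero_le_divide_1_iff zero_le_numeral divide_nonneg_nonneg simp_thms)
        finally show "ennreal ((norm (T k (snd z) - snd z))\<^sup>2)
            \<le> ennreal (1 + ?t) * ennreal ((norm (fst z - snd z))\<^sup>2)
            + ennreal (1 + 1 / ?t) * ennreal ((norm (fst z - T k (snd z)))\<^sup>2)" .
      qed
      also have "\<dots> = ennreal (1 + ?t) * transport_cost (\<gamma> k) + ennreal (1 + 1 / ?t) * map_error (\<gamma> k) (T k)"
        using m_cost m_err[of k] by (simp add: nn_integral_add nn_integral_cmult transport_cost_eq)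
      also have "\<dots> \<le> ennreal (1 + ?t) * ennreal (b + ?t) + ennreal (1 + 1 / ?t) * ennreal ((1/16)^k)"
        using cost[of k] err[of k] b by (intro add_mono mult_left_mono) auto
      also have "\<dots> = ennreal ((1 + ?t) * (b + ?t) + (1 + 1 / ?t) * (1/16)^k)"
        using b by (simp only: ennreal_plus[symmetric] ennreal_mult[symmetric] zero_le_mult_iff add_nonneg_nonneg
              zero_le_one zero_le_power zero_le_divide_1_iff zero_le_numeral divide_nonneg_nonneg simp_thms)
      also have "(1 + 1 / ?t) * (1/16)^k = (1/16)^k + (1/8)^k"
      proof -
        have "1 / ?t = 2^k" by (simp add: power_divide)
        moreover have "(2::real)^k * (1/16)^k = (1/8)^k" by (simp flip: power_mult_distrib)
        ultimately have "1 / ?t * (1/16)^k = (1/8)^k" by (simp only:)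
        then show ?thesis by (simp only: distrib_right mult_1)
      qed
      finally show ?thesis .
    qed
  qed
  then have "transport_cost (distr \<nu> borel (\<lambda>y. (S y, y))) \<le> MK2 m (\<mu> j) \<nu>"
    unfolding transport_cost_eq by (subst nn_integral_distr[OF pair]) auto
  then show ?thesis using coup S unfolding optimal_map_def Opt_iff by blast
qed

end

section \<open>Correspondence of the minimizers\<close>

context barycenter_problem
begin

text \<open>The graph coupling of \<open>T\<close> is optimal and hence concentrated on the graph of
  \<open>S\<close>.\<close>

lemma optimal_map_unique:
  assumes "BC_optimal m \<mu> \<nu>" "optimal_map m (\<mu> j) \<nu> S" "optimal_map m (\<mu> j) \<nu> T"
  shows "AE y in \<nu>. T y = S y"
proof -
  have s\<nu>: "sets \<nu> = sets borel"
    using assms(1) measures_of_massD by (auto simp: BC_optimal_iff)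
  have [measurable]: "T \<in> borel_measurable borel" using assms(3) by (simp add: optimal_map_def)
  have pair: "(\<lambda>y. (T y, y)) \<in> \<nu> \<rightarrow>\<^sub>M borel"
    unfolding measurable_cong_sets[OF s\<nu> refl] borel_prod[symmetric] by measurable
  have "AE z in distr \<nu> borel (\<lambda>y. (T y, y)). fst z = S (snd z)"
    using assms by (intro Opt_concentrated_on_optimal_map) (auto simp: optimal_map_def)
  from AE_distrD[OF pair this] show ?thesis by simp
qed

text \<open>The graph couplings share the variable \<open>y\<close> and are glued exactly, without
  cells. The integrated variance identity bounds the spread plus the weighted deviation of the
  average from \<open>y\<close> by \<open>BC_cost \<nu>\<close>, which in turn is at most the
  spread. Hence \<sigma> is optimal and, the values being finite, the average equals
  \<open>y\<close> almost everywhere.\<close>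

lemma optimal_maps_push_forward:
  assumes opt: "BC_optimal m \<mu> \<nu>" and S: "\<And>j. optimal_map m (\<mu> j) \<nu> (S j)"
  defines "\<sigma> \<equiv> distr \<nu> borel (\<lambda>y. \<chi> j. S j y)"
  shows "MM_optimal m \<mu> \<sigma>" and "distr \<sigma> borel average = \<nu>"
proof -
  let ?N = "real CARD('N)"
  have \<nu>: "\<nu> \<in> measures_of_mass m" using opt by (simp add: BC_optimal_iff)
  have s\<nu>: "sets \<nu> = sets borel" and mass\<nu>: "mass \<nu> = ennreal m" using measures_of_massD[OF \<nu>] by auto
  note m\<nu> = measurable_cong_sets[OF s\<nu> refl]
  have Sm[measurable]: "S j \<in> borel_measurable borel" for j using S[of j] by (simp add: optimal_map_def)
  have Opt: "distr \<nu> borel (\<lambda>y. (S j y, y)) \<in> Opt m (\<mu> j) \<nu>" for j using S[of j] by (simp add: optimal_map_def)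
  have pair: "(\<lambda>y. (S j y, y)) \<in> \<nu> \<rightarrow>\<^sub>M borel" for j
    unfolding m\<nu> borel_prod[symmetric] by measurable
  have X: "(\<lambda>y. \<chi> j. S j y) \<in> \<nu> \<rightarrow>\<^sub>M borel" unfolding m\<nu> by measurable
  have avg: "(\<lambda>y. average (\<chi> j. S j y)) \<in> \<nu> \<rightarrow>\<^sub>M borel" unfolding m\<nu> by measurable
  have "distr \<sigma> borel (\<lambda>x. x $ j) \<le> \<mu> j" for j
  proof -
    have "distr \<sigma> borel (\<lambda>x. x $ j) = distr \<nu> borel (S j)"
      unfolding \<sigma>_def by (simp add: distr_distr X comp_def)
    also have "\<dots> = distr (distr \<nu> borel (\<lambda>y. (S j y, y))) borel fst"
      by (simp add: distr_distr pair comp_def)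
    also have "\<dots> \<le> \<mu> j" using Opt[of j] by (simp add: Opt_iff partial_couplings_def)
    finally show ?thesis .
  qed
  moreover have "mass \<sigma> = ennreal m"
    using mass\<nu> by (simp add: mass_def \<sigma>_def emeasure_distr[OF X])
  ultimately have coup: "multi_coupling \<sigma>" by (simp add: multi_partial_couplings_def \<sigma>_def)
  have "spread_cost \<sigma> = (\<integral>\<^sup>+y. ennreal (spread (\<chi> j. S j y)) \<partial>\<nu>)"
    unfolding \<sigma>_def by (rule nn_integral_distr[OF X]) simp
  moreover have "(\<integral>\<^sup>+y. ennreal (spread (\<chi> j. S j y)) \<partial>\<nu>)
      + (\<integral>\<^sup>+y. ennreal (?N * (norm (average (\<chi> j. S j y) - y))\<^sup>2) \<partial>\<nu>) \<le> BC_cost \<nu>"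
  proof -
    have m1: "(\<lambda>y. ennreal (spread (\<chi> j. S j y))) \<in> borel_measurable \<nu>"
      "(\<lambda>y. ennreal (?N * (norm (average (\<chi> j. S j y) - y))\<^sup>2)) \<in> borel_measurable \<nu>"
      "(\<lambda>y. ennreal ((norm (S j y - y))\<^sup>2)) \<in> borel_measurable \<nu>" for j
      unfolding m\<nu> by measurable
    have "(\<integral>\<^sup>+y. ennreal (spread (\<chi> j. S j y)) \<partial>\<nu>)
      + (\<integral>\<^sup>+y. ennreal (?N * (norm (average (\<chi> j. S j y) - y))\<^sup>2) \<partial>\<nu>)
      = (\<integral>\<^sup>+y. ennreal (spread (\<chi> j. S j y)) + ennreal (?N * (norm (average (\<chi> j. S j y) - y))\<^sup>2) \<partial>\<nu>)"
      by (rule nn_integral_add[symmetric]) (use m1 in auto)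
    also have "\<dots> = (\<integral>\<^sup>+y. (\<Sum>j\<in>UNIV. ennreal ((norm (S j y - y))\<^sup>2)) \<partial>\<nu>)"
      using sum_dist_sq_eq_spread[of "\<chi> j. S j y" y for y]
      by (simp add: spread_nonneg flip: ennreal_plus)
    also have "\<dots> = (\<Sum>j\<in>UNIV. \<integral>\<^sup>+y. ennreal ((norm (S j y - y))\<^sup>2) \<partial>\<nu>)"
      by (rule nn_integral_sum) (rule m1)
    also have "\<dots> = (\<Sum>j\<in>UNIV. transport_cost (distr \<nu> borel (\<lambda>y. (S j y, y))))"
      unfolding transport_cost_eq by (simp add: nn_integral_distr[OF pair])
    also have "\<dots> \<le> BC_cost \<nu>" using Opt by (intro sum_mono) (simp add: Opt_iff)
    finally show ?thesis .
  qed
  ultimately have le: "spread_cost \<sigma> + (\<integral>\<^sup>+y. ennreal (?N * (norm (average (\<chi> j. S j y) - y))\<^sup>2) \<partial>\<nu>) \<le> BC_cost \<nu>"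
    by simp
  have BC_le: "BC_cost \<nu> \<le> spread_cost \<sigma>'" if "multi_coupling \<sigma>'" for \<sigma>'
    using opt multi_coupling_average(1,4)[OF that] unfolding BC_optimal_iff by (blast intro: order_trans)
  have "spread_cost \<sigma> \<le> BC_cost \<nu>" by (rule order_trans[OF _ le]) simp
  then show "MM_optimal m \<mu> \<sigma>"
    unfolding MM_optimal_iff using coup BC_le by (blast intro: order_trans)
  have "BC_cost \<nu> + (\<integral>\<^sup>+y. ennreal (?N * (norm (average (\<chi> j. S j y) - y))\<^sup>2) \<partial>\<nu>) \<le> BC_cost \<nu> + 0"
    using order_trans[OF add_right_mono[OF BC_le[OF coup]] le] by (simp only: add_0_right)
  moreover have "BC_cost \<nu> \<noteq> \<infinity>" using BC_cost_finite[OF \<nu>] by (rule less_imp_neq)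
  ultimately have "(\<integral>\<^sup>+y. ennreal (?N * (norm (average (\<chi> j. S j y) - y))\<^sup>2) \<partial>\<nu>) \<le> 0"
    unfolding ennreal_add_left_cancel_le by blast
  moreover have "(\<lambda>y. ennreal (?N * (norm (average (\<chi> j. S j y) - y))\<^sup>2)) \<in> borel_measurable \<nu>"
    unfolding m\<nu> by measurable
  ultimately have "AE y in \<nu>. ennreal (?N * (norm (average (\<chi> j. S j y) - y))\<^sup>2) = 0"
    by (simp add: nn_integral_0_iff_AE)
  then have "AE y in \<nu>. average (\<chi> j. S j y) = y" by (rule AE_mp) simp
  then have "distr \<nu> borel (\<lambda>y. average (\<chi> j. S j y)) = distr \<nu> \<nu> (\<lambda>y. y)"
    by (intro distr_cong_AE) (auto simp: s\<nu> avg)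
  then show "distr \<sigma> borel average = \<nu>"
    unfolding \<sigma>_def by (simp add: distr_distr X comp_def)
qed

text \<open>The two optimal values agree, so the laws of \<open>x $ j\<close> and
  \<open>average x\<close> are optimal couplings. Each is concentrated on the graph of
  \<open>S j\<close>, and therefore the average determines all of \<open>x\<close>.\<close>

lemma MM_optimal_eq_push_forward:
  assumes \<sigma>: "MM_optimal m \<mu> \<sigma>"
    and S: "\<And>j. optimal_map m (\<mu> j) (distr \<sigma> borel average) (S j)"
  shows "\<sigma> = distr (distr \<sigma> borel average) borel (\<lambda>y. \<chi> j. S j y)"
proof -
  define \<nu> where "\<nu> = distr \<sigma> borel average"
  define \<gamma> where "\<gamma> j = distr \<sigma> borel (\<lambda>x. (x $ j, average x))" for j
  have opt: "BC_optimal m \<mu> \<nu>" unfolding \<nu>_def by (rule BC_optimal_average[OF \<sigma>])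
  then have \<nu>: "\<nu> \<in> measures_of_mass m" by (simp add: BC_optimal_iff)
  have coup: "multi_coupling \<sigma>" using \<sigma> by (simp add: MM_optimal_iff)
  then have s: "sets \<sigma> = sets borel" by (simp add: multi_partial_couplings_def)
  note m\<sigma> = measurable_cong_sets[OF s refl]
  have [measurable]: "S j \<in> borel_measurable borel" for j using S[of j] by (simp add: optimal_map_def)
  have \<gamma>: "coupling j \<nu> (\<gamma> j)" for j
    using multi_coupling_average(2)[OF coup, of j] by (simp only: \<nu>_def \<gamma>_def)
  have "spread_cost \<sigma> \<le> BC_cost \<nu>"
    using \<sigma> by (intro spread_lower_bound_le_BC_cost \<nu>) (simp add: MM_optimal_iff)
  then have "(\<Sum>j\<in>UNIV. transport_cost (\<gamma> j)) \<le> BC_cost \<nu>"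
    using multi_coupling_average(3)[OF coup] by (simp add: \<gamma>_def)
  then have "transport_cost (\<gamma> j) = MK2 m (\<mu> j) \<nu>" for j
    using \<gamma> BC_cost_finite[OF \<nu>]
    by (intro sum_ennreal_eq_pointwise[where I = UNIV and g = "\<lambda>j. MK2 m (\<mu> j) \<nu>" and f = "\<lambda>j. transport_cost (\<gamma> j)"] MK2_le) auto
  then have Opt: "\<gamma> j \<in> Opt m (\<mu> j) \<nu>" for j using \<gamma> by (simp add: Opt_iff)
  have "AE x in \<sigma>. x $ j = S j (average x)" for j
  proof -
    have pair: "(\<lambda>x. (x $ j, average x)) \<in> \<sigma> \<rightarrow>\<^sub>M borel"
      unfolding m\<sigma> borel_prod[symmetric] by measurable
    have "AE z in \<gamma> j. fst z = S j (snd z)"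
      by (rule Opt_concentrated_on_optimal_map[OF opt Opt]) (simp add: S \<nu>_def)
    from AE_distrD[OF pair this[unfolded \<gamma>_def]] show ?thesis by simp
  qed
  then have "AE x in \<sigma>. \<forall>j. x $ j = S j (average x)" unfolding AE_all_countable by blast
  then have "AE x in \<sigma>. x = (\<chi> j. S j (average x))" by (rule AE_mp) (simp add: vec_eq_iff)
  moreover have "(\<lambda>x. \<chi> j. S j (average x)) \<in> \<sigma> \<rightarrow>\<^sub>M borel" unfolding m\<sigma> by measurable
  ultimately have "distr \<sigma> \<sigma> (\<lambda>x. x) = distr \<sigma> borel (\<lambda>x. \<chi> j. S j (average x))"
    by (intro distr_cong_AE) (auto simp: s)
  moreover have "average \<in> \<sigma> \<rightarrow>\<^sub>M borel" unfolding m\<sigma> by measurable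
  ultimately show ?thesis by (simp add: distr_distr comp_def)
qed

lemma exists_optimal_maps:
  assumes "BC_optimal m \<mu> \<nu>"
  obtains S where "\<And>j. optimal_map m (\<mu> j) \<nu> (S j)"
  using exists_optimal_map[OF assms] by metis

text \<open>Existence of optimal maps is used in both directions: it exhibits any barycenter
  minimizer as the average of a multi-marginal one, and it produces a multi-marginal minimizer from
  a barycenter.\<close>

lemma unique_MM_optimal_iff_unique_BC_optimal:
  "(\<exists>!\<sigma>. MM_optimal m \<mu> \<sigma>) \<longleftrightarrow> (\<exists>!\<nu>. BC_optimal m \<mu> \<nu>)"
proof
  assume "\<exists>!\<sigma>. MM_optimal m \<mu> \<sigma>"
  then obtain \<sigma> where \<sigma>: "MM_optimal m \<mu> \<sigma>" and uniq: "\<And>\<sigma>'. MM_optimal m \<mu> \<sigma>' \<Longrightarrow> \<sigma>' = \<sigma>" by blast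
  show "\<exists>!\<nu>. BC_optimal m \<mu> \<nu>"
  proof (rule ex1I)
    show "BC_optimal m \<mu> (distr \<sigma> borel average)" by (rule BC_optimal_average[OF \<sigma>])
    fix \<nu> assume \<nu>: "BC_optimal m \<mu> \<nu>"
    obtain S where S: "\<And>j. optimal_map m (\<mu> j) \<nu> (S j)" using exists_optimal_maps[OF \<nu>] by blast
    show "\<nu> = distr \<sigma> borel average"
      using optimal_maps_push_forward[OF \<nu> S] uniq by metis
  qed
next
  assume "\<exists>!\<nu>. BC_optimal m \<mu> \<nu>"
  then obtain \<nu> where \<nu>: "BC_optimal m \<mu> \<nu>" and uniq: "\<And>\<nu>'. BC_optimal m \<mu> \<nu>' \<Longrightarrow> \<nu>' = \<nu>" by blast
  obtain S where S: "\<And>j. optimal_map m (\<mu> j) \<nu> (S j)" using exists_optimal_maps[OF \<nu>] by blast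
  show "\<exists>!\<sigma>. MM_optimal m \<mu> \<sigma>"
  proof (rule ex1I)
    show "MM_optimal m \<mu> (distr \<nu> borel (\<lambda>y. \<chi> j. S j y))" by (rule optimal_maps_push_forward[OF \<nu> S])
    fix \<sigma> assume \<sigma>: "MM_optimal m \<mu> \<sigma>"
    have "distr \<sigma> borel average = \<nu>" by (rule uniq[OF BC_optimal_average[OF \<sigma>]])
    then show "\<sigma> = distr \<nu> borel (\<lambda>y. \<chi> j. S j y)" using MM_optimal_eq_push_forward[OF \<sigma>, of S] S by simp
  qed
qed

end

text \<open>Speaking of "the" optimal mapping in (ii) is itself a claim. The conclusion therefore
  contains existence and \<nu>-almost everywhere uniqueness of the maps, and asserts optimality of
  the push-forward for every choice of their versions.\<close>

theorem proposition1p1: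
  fixes \<mu> :: "'N::finite \<Rightarrow> (real^'n) measure" and m :: real
  assumes "\<And>j. borel_measure2 (\<mu> j)"
    and "\<And>j. absolutely_continuous lborel (\<mu> j)"
    and "\<And>j. mass (\<mu> j) < \<infinity>"
    and "0 < m" and "ennreal m \<le> Min (range (\<lambda>j. mass (\<mu> j)))"
  shows "(\<forall>\<sigma>. MM_optimal m \<mu> \<sigma> \<longrightarrow> BC_optimal m \<mu> (distr \<sigma> borel average)) \<and>
    (\<forall>\<nu>. BC_optimal m \<mu> \<nu> \<longrightarrow>
        (\<forall>j. \<exists>S. optimal_map m (\<mu> j) \<nu> S \<and>
            (\<forall>T. optimal_map m (\<mu> j) \<nu> T \<longrightarrow> (AE y in \<nu>. T y = S y))) \<and>
        (\<forall>S. (\<forall>j. optimal_map m (\<mu> j) \<nu> (S j)) \<longrightarrow>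
            MM_optimal m \<mu> (distr \<nu> borel (\<lambda>y. \<chi> j. S j y)))) \<and>
    ((\<exists>!\<sigma>. MM_optimal m \<mu> \<sigma>) \<longleftrightarrow> (\<exists>!\<nu>. BC_optimal m \<mu> \<nu>))"
proof -
  have "ennreal m \<le> mass (\<mu> j)" for j
    using assms(5) Min_le[of "range (\<lambda>j. mass (\<mu> j))" "mass (\<mu> j)"] by (auto intro: order_trans)
  then interpret barycenter_problem \<mu> m
    by unfold_locales (rule assms | assumption)+
  show ?thesis
  proof (intro conjI allI impI)
    show "BC_optimal m \<mu> (distr \<sigma> borel average)" if "MM_optimal m \<mu> \<sigma>" for \<sigma>
      by (rule BC_optimal_average[OF that])
    show "\<exists>S. optimal_map m (\<mu> j) \<nu> S \<and> (\<forall>T. optimal_map m (\<mu> j) \<nu> T \<longrightarrow> (AE y in \<nu>. T y = S y))"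
      if "BC_optimal m \<mu> \<nu>" for \<nu> j
      using exists_optimal_map[OF that, of j] optimal_map_unique[OF that] by blast
    show "MM_optimal m \<mu> (distr \<nu> borel (\<lambda>y. \<chi> j. S j y))"
      if "BC_optimal m \<mu> \<nu>" "\<forall>j. optimal_map m (\<mu> j) \<nu> (S j)" for \<nu> S
      using optimal_maps_push_forward(1)[OF that(1)] that(2) by blast
    show "(\<exists>!\<sigma>. MM_optimal m \<mu> \<sigma>) \<longleftrightarrow> (\<exists>!\<nu>. BC_optimal m \<mu> \<nu>)"
      by (rule unique_MM_optimal_iff_unique_BC_optimal)
  qed
qed

end
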